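(* Let $p\ge1$ be an integer and let $\varepsilon_0>0$ be a constant with the stability property stated in the context. Suppose that $\Gamma:\mathbb{S}^1\times[0,T)\to\mathcal{M}^2$ is the $2(p+1)$-anisotropic polyharmonic curve flow whose initial curve $\Gamma_0=\Gamma(\cdot,0)$ is a regular smooth immersed closed curve with $\mathscr{A}(\Gamma_0)>0$, $\mathscr{K}_{osc}(\Gamma_0)<\varepsilon_0$ and $\mathscr{I}(\Gamma_0)<\exp\big(\varepsilon_0/(8\mathscr{A}(\tilde{\mathcal I})^2)\big)$ (so that $T=\infty$). Then $$\mathcal{L}\{t\in[0,\infty):\kappa(\cdot,t)\not>0\}\le\frac{8\,\mathscr{A}(\tilde{\mathcal I})^{p-1}\mathscr{A}(\Gamma_0)^{p+1}}{(p+1)\pi^{2p}}\left(\mathscr{I}(\Gamma_0)^{p+1}-1\right),$$ where $\mathcal{L}$ denotes Lebesgue measure on $[0,\infty)$ and $\kappa(\cdot,t)\not>0$ means that there is at least one $\sigma_0$ with $\kappa(\sigma_0,t)\le0$.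
   Context: Setting. $\mathcal{U}\subset\mathbb{R}^2$ is a convex domain, centrally symmetric about the origin, with smooth boundary of strictly positive Euclidean curvature; its boundary, the indicatrix, is $\partial\mathcal U=\{(r(\theta)\cos\theta,r(\theta)\sin\theta):\theta\in[0,2\pi)\}$ with $r>0$, $r(\theta+\pi)=r(\theta)$. Put $h=1/r$. The Minkowski plane $\mathcal{M}^2$ is $\mathbb{R}^2$ with the norm $l(x)=|x|/r(\theta)$ for $x=|x|(\cos\theta,\sin\theta)$. For a regular closed curve $\Gamma:\mathbb{S}^1\to\mathcal{M}^2$ let $s$ be Euclidean arc length, $\tau=\Gamma_s=(\cos\theta,\sin\theta)$, $n=(-\sin\theta,\cos\theta)$, and $k=\theta_s$ the Euclidean curvature; functions of $\theta$ such as $h,h_\theta,h_{\theta\theta}$ are evaluated along $\Gamma$ at the tangent angle $\theta$. The Minkowski arc length element is $d\sigma=h\,ds$, so $\partial_\sigma=h^{-1}\partial_s$, and $f_{\sigma^m}=\partial_\sigma^m f$. The Minkowski normal is $N=-h_\theta\tau+hn$ and the Minkowski curvature is $\kappa=k(h+h_{\theta\theta})$. The Minkowski length is $\mathscr{L}(\Gamma)=\int_\Gamma d\sigma$, the enclosed area is $\mathscr{A}(\Gamma)=-\frac12\int_\Gamma(\Gamma,n)\,ds$ (Euclidean inner product), and $\bar\kappa=\mathscr{L}^{-1}\int_\Gamma\kappa\,d\sigma$. The isoperimetrix $\tilde{\mathcal I}$ is the convex curve $\{-h_\theta(\cos\theta,\sin\theta)+h(-\sin\theta,\cos\theta):\theta\in[0,2\pi)\}$,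 and $\mathscr{A}(\tilde{\mathcal I})>0$ is the area it encloses. Define $$\mathscr{K}_{osc}(\Gamma)=\mathscr{L}(\Gamma)\int_\Gamma(\kappa-\bar\kappa)^2\,d\sigma,\qquad \mathscr{I}(\Gamma)=\frac{\mathscr{L}(\Gamma)^2}{4\mathscr{A}(\Gamma)\mathscr{A}(\tilde{\mathcal I})}.$$ The $2(p+1)$-anisotropic polyharmonic curve flow is the smooth one-parameter family of closed immersed curves $\Gamma:\mathbb{S}^1\times[0,T)\to\mathcal{M}^2$ solving $\partial_t\Gamma=(-1)^p\kappa_{\sigma^{2p}}N$ ($T$ the maximal existence time). Stability property of $\varepsilon_0$: for every regular smooth immersed closed curve $\Gamma_0$ with $\mathscr{A}(\Gamma_0)>0$, $\mathscr{K}_{osc}(\Gamma_0)<\varepsilon_0$ and $\mathscr{I}(\Gamma_0)<\exp(\varepsilon_0/(8\mathscr{A}(\tilde{\mathcal I})^2))$, the flow with initial data $\Gamma_0$ exists for all time and converges exponentially fast to a homothetic rescaling $x_0+\lambda\tilde{\mathcal I}$ ($\lambda>0$) of the isoperimetrix with enclosed area $\mathscr{A}(\Gamma_0)$ (in particular each $\int_\Gamma\kappa_{\sigma^m}^2\,d\sigma$, $m\ge1$, decays exponentially for large $t$). *)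

theory Defs
  imports "HOL-Analysis.Analysis"
begin

text \<open>
  The plane \<open>\<real>\<^sup>2\<close> is modelled by \<^typ>\<open>complex\<close>: \<open>cis \<theta>\<close> is \<open>(cos \<theta>, sin \<theta>)\<close>, multiplication by
  \<^term>\<open>\<i>\<close> is the rotation by \<open>\<pi>/2\<close>, and \<open>x \<bullet> y\<close> is the Euclidean inner product. Maps on the circle
  are \<open>2\<pi>\<close>-periodic functions of a real parameter.
\<close>

definition vderiv :: "(real \<Rightarrow> 'a::real_normed_vector) \<Rightarrow> real \<Rightarrow> 'a" where
  "vderiv f u = vector_derivative f (at u)"

definition smooth_fun :: "(real \<Rightarrow> 'a::real_normed_vector) \<Rightarrow> bool" where
  "smooth_fun f \<longleftrightarrow> (\<forall>m u. (vderiv ^^ m) f differentiable (at u))"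

definition regular_closed_curve :: "(real \<Rightarrow> complex) \<Rightarrow> bool" where
  "regular_closed_curve \<gamma> \<longleftrightarrow>
     smooth_fun \<gamma> \<and> (\<forall>u. \<gamma> (u + 2 * pi) = \<gamma> u) \<and> (\<forall>u. vderiv \<gamma> u \<noteq> 0)"


section \<open>Euclidean geometry of curves\<close>

definition curve_speed :: "(real \<Rightarrow> complex) \<Rightarrow> real \<Rightarrow> real" where
  "curve_speed \<gamma> u = norm (vderiv \<gamma> u)"

text \<open>The operator \<open>\<partial>\<^sub>s\<close>, acting on functions of the curve parameter.\<close>

definition arc_deriv :: "(real \<Rightarrow> complex) \<Rightarrow> (real \<Rightarrow> 'a::real_normed_vector) \<Rightarrow> real \<Rightarrow> 'a" where
  "arc_deriv \<gamma> f u = vderiv f u /\<^sub>R curve_speed \<gamma> u"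

definition unit_tangent :: "(real \<Rightarrow> complex) \<Rightarrow> real \<Rightarrow> complex" where
  "unit_tangent \<gamma> = arc_deriv \<gamma> \<gamma>"

definition unit_normal :: "(real \<Rightarrow> complex) \<Rightarrow> real \<Rightarrow> complex" where
  "unit_normal \<gamma> u = \<i> * unit_tangent \<gamma> u"

text \<open>
  A differentiable lift \<open>\<theta>\<close> of the tangent direction to the universal cover. For a regular smooth curve
  it exists and is unique up to an additive constant in \<open>2\<pi>\<int>\<close>, which affects neither \<open>\<theta>\<^sub>s\<close> nor
  \<open>2\<pi>\<close>-periodic functions of \<open>\<theta>\<close>.
\<close>

definition tangent_angle :: "(real \<Rightarrow> complex) \<Rightarrow> real \<Rightarrow> real" where
  "tangent_angle \<gamma> =
     (SOME \<theta>. (\<forall>u. \<theta> differentiable (at u)) \<and> (\<forall>u. unit_tangent \<gamma> u = cis (\<theta> u)))"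

definition euclidean_curvature :: "(real \<Rightarrow> complex) \<Rightarrow> real \<Rightarrow> real" where
  "euclidean_curvature \<gamma> = arc_deriv \<gamma> (tangent_angle \<gamma>)"

definition enclosed_area :: "(real \<Rightarrow> complex) \<Rightarrow> real" where
  "enclosed_area \<gamma> =
     - (1 / 2) * integral {0..2 * pi} (\<lambda>u. (\<gamma> u \<bullet> unit_normal \<gamma> u) * curve_speed \<gamma> u)"


section \<open>The Minkowski plane\<close>

text \<open>
  \<open>U\<close> is the unit ball and \<open>r\<close> its radial function. As \<open>U\<close> is convex and contains the origin, its boundary is
  smooth iff \<open>r\<close> is; it is oriented counterclockwise by \<open>\<theta>\<close>, so that positive curvature has the usual sign.
\<close>

definition minkowski_domain :: "complex set \<Rightarrow> (real \<Rightarrow> real) \<Rightarrow> bool" where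
  "minkowski_domain U r \<longleftrightarrow>
     open U \<and> U \<noteq> {} \<and> convex U \<and> (\<forall>x\<in>U. - x \<in> U) \<and>
     frontier U = (\<lambda>\<theta>. r \<theta> *\<^sub>R cis \<theta>) ` {0..<2 * pi} \<and>
     (\<forall>\<theta>. r \<theta> > 0) \<and> (\<forall>\<theta>. r (\<theta> + pi) = r \<theta>) \<and>
     smooth_fun r \<and>
     (\<forall>\<theta>. euclidean_curvature (\<lambda>\<theta>. r \<theta> *\<^sub>R cis \<theta>) \<theta> > 0)"

text \<open>In what follows \<open>h\<close> is the reciprocal \<open>1 / r\<close> of the radial function.\<close>

definition mink_deriv ::
  "(real \<Rightarrow> real) \<Rightarrow> (real \<Rightarrow> complex) \<Rightarrow> (real \<Rightarrow> real) \<Rightarrow> real \<Rightarrow> real" where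
  "mink_deriv h \<gamma> f u = arc_deriv \<gamma> f u / h (tangent_angle \<gamma> u)"

text \<open>The integral of \<open>f\<close> along \<open>\<gamma>\<close> with respect to \<open>d\<sigma> = h ds\<close>.\<close>

definition mink_integral :: "(real \<Rightarrow> real) \<Rightarrow> (real \<Rightarrow> complex) \<Rightarrow> (real \<Rightarrow> real) \<Rightarrow> real" where
  "mink_integral h \<gamma> f =
     integral {0..2 * pi} (\<lambda>u. f u * h (tangent_angle \<gamma> u) * curve_speed \<gamma> u)"

definition mink_length :: "(real \<Rightarrow> real) \<Rightarrow> (real \<Rightarrow> complex) \<Rightarrow> real" where
  "mink_length h \<gamma> = mink_integral h \<gamma> (\<lambda>_. 1)"

definition mink_normal :: "(real \<Rightarrow> real) \<Rightarrow> (real \<Rightarrow> complex) \<Rightarrow> real \<Rightarrow> complex" where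
  "mink_normal h \<gamma> u =
     - vderiv h (tangent_angle \<gamma> u) *\<^sub>R unit_tangent \<gamma> u + h (tangent_angle \<gamma> u) *\<^sub>R unit_normal \<gamma> u"

definition mink_curvature :: "(real \<Rightarrow> real) \<Rightarrow> (real \<Rightarrow> complex) \<Rightarrow> real \<Rightarrow> real" where
  "mink_curvature h \<gamma> u =
     euclidean_curvature \<gamma> u * (h (tangent_angle \<gamma> u) + vderiv (vderiv h) (tangent_angle \<gamma> u))"

text \<open>\<open>mink_curvature_deriv h \<gamma> m\<close> is \<open>\<partial>\<^sub>\<sigma>\<^sup>m \<kappa>\<close>.\<close>

definition mink_curvature_deriv ::
  "(real \<Rightarrow> real) \<Rightarrow> (real \<Rightarrow> complex) \<Rightarrow> nat \<Rightarrow> real \<Rightarrow> real" where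
  "mink_curvature_deriv h \<gamma> m = (mink_deriv h \<gamma> ^^ m) (mink_curvature h \<gamma>)"

definition mean_curvature :: "(real \<Rightarrow> real) \<Rightarrow> (real \<Rightarrow> complex) \<Rightarrow> real" where
  "mean_curvature h \<gamma> = mink_integral h \<gamma> (mink_curvature h \<gamma>) / mink_length h \<gamma>"

definition curvature_osc :: "(real \<Rightarrow> real) \<Rightarrow> (real \<Rightarrow> complex) \<Rightarrow> real" where
  "curvature_osc h \<gamma> =
     mink_length h \<gamma> * mink_integral h \<gamma> (\<lambda>u. (mink_curvature h \<gamma> u - mean_curvature h \<gamma>)\<^sup>2)"

text \<open>
  This parametrization is counterclockwise (its \<open>\<theta>\<close>-derivative is \<open>- (h + h'') cis \<theta>\<close>), so
  \<open>enclosed_area (isoperimetrix h)\<close> is the positive area that the isoperimetrix encloses.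
\<close>

definition isoperimetrix :: "(real \<Rightarrow> real) \<Rightarrow> real \<Rightarrow> complex" where
  "isoperimetrix h \<theta> = - vderiv h \<theta> *\<^sub>R cis \<theta> + h \<theta> *\<^sub>R (\<i> * cis \<theta>)"

definition isoperimetric_ratio :: "(real \<Rightarrow> real) \<Rightarrow> (real \<Rightarrow> complex) \<Rightarrow> real" where
  "isoperimetric_ratio h \<gamma> =
     (mink_length h \<gamma>)\<^sup>2 / (4 * enclosed_area \<gamma> * enclosed_area (isoperimetrix h))"


section \<open>The anisotropic polyharmonic curve flow\<close>

definition time_interval :: "ereal \<Rightarrow> real set" where
  "time_interval T = {t. 0 \<le> t \<and> ereal t < T}"

text \<open>
  Joint smoothness up to the initial time: \<open>D i j\<close> is the partial derivative of order \<open>i\<close> in time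
  (one-sided at \<open>t = 0\<close>) and order \<open>j\<close> in the curve parameter; all of them exist and are continuous.
\<close>

definition smooth_family :: "ereal \<Rightarrow> (real \<Rightarrow> real \<Rightarrow> complex) \<Rightarrow> bool" where
  "smooth_family T \<Gamma> \<longleftrightarrow>
     (\<exists>D :: nat \<Rightarrow> nat \<Rightarrow> real \<Rightarrow> real \<Rightarrow> complex.
        (\<forall>t\<in>time_interval T. \<forall>u. D 0 0 t u = \<Gamma> t u) \<and>
        (\<forall>i j. continuous_on (time_interval T \<times> UNIV) (\<lambda>(t, u). D i j t u) \<and>
           (\<forall>t\<in>time_interval T. \<forall>u.
              ((\<lambda>v. D i j t v) has_vector_derivative D i (Suc j) t u) (at u) \<and>
              ((\<lambda>s. D i j s u) has_vector_derivative D (Suc i) j t u)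
                (at t within time_interval T))))"

text \<open>\<open>\<Gamma> t\<close> is the curve at time \<open>t\<close>; only its values for \<open>t\<close> in \<open>[0, T)\<close> are relevant.\<close>

definition polyharmonic_flow ::
  "(real \<Rightarrow> real) \<Rightarrow> nat \<Rightarrow> ereal \<Rightarrow> (real \<Rightarrow> real \<Rightarrow> complex) \<Rightarrow> bool" where
  "polyharmonic_flow h p T \<Gamma> \<longleftrightarrow>
     0 < T \<and> smooth_family T \<Gamma> \<and>
     (\<forall>t\<in>time_interval T. regular_closed_curve (\<Gamma> t)) \<and>
     (\<forall>t\<in>time_interval T. \<forall>u.
        ((\<lambda>s. \<Gamma> s u) has_vector_derivative
           ((-1) ^ p * mink_curvature_deriv h (\<Gamma> t) (2 * p) u) *\<^sub>R mink_normal h (\<Gamma> t) u)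
          (at t within time_interval T))"

definition maximal_polyharmonic_flow ::
  "(real \<Rightarrow> real) \<Rightarrow> nat \<Rightarrow> ereal \<Rightarrow> (real \<Rightarrow> real \<Rightarrow> complex) \<Rightarrow> bool" where
  "maximal_polyharmonic_flow h p T \<Gamma> \<longleftrightarrow>
     polyharmonic_flow h p T \<Gamma> \<and>
     \<not> (\<exists>T' \<Gamma>'. T < T' \<and> polyharmonic_flow h p T' \<Gamma>' \<and> (\<forall>t\<in>time_interval T. \<Gamma>' t = \<Gamma> t))"

text \<open>Orientation-preserving diffeomorphisms of the circle, lifted to the real line.\<close>

definition circle_reparametrization :: "(real \<Rightarrow> real) \<Rightarrow> bool" where
  "circle_reparametrization \<phi> \<longleftrightarrow>
     smooth_fun \<phi> \<and> (\<forall>u. vderiv \<phi> u > 0) \<and> (\<forall>u. \<phi> (u + 2 * pi) = \<phi> u + 2 * pi)"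

text \<open>
  Exponentially fast convergence in the smooth topology to a closed curve \<open>\<gamma>\<close>, up to reparametrization:
  every derivative converges exponentially, at a rate that may depend on its order.
\<close>

definition converges_exponentially ::
  "(real \<Rightarrow> real \<Rightarrow> complex) \<Rightarrow> (real \<Rightarrow> complex) \<Rightarrow> bool" where
  "converges_exponentially \<Gamma> \<gamma> \<longleftrightarrow>
     (\<exists>\<phi> :: real \<Rightarrow> real \<Rightarrow> real.
        (\<forall>t\<ge>0. circle_reparametrization (\<phi> t)) \<and>
        (\<forall>m. \<exists>C. \<exists>\<delta>>0. \<forall>\<^sub>F t in at_top. \<forall>u.
           norm ((vderiv ^^ m) (\<lambda>v. \<Gamma> t (\<phi> t v) - \<gamma> v) u) \<le> C * exp (- \<delta> * t)))"

definition almost_isoperimetric ::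
  "(real \<Rightarrow> real) \<Rightarrow> real \<Rightarrow> (real \<Rightarrow> complex) \<Rightarrow> bool" where
  "almost_isoperimetric h \<epsilon> \<gamma> \<longleftrightarrow>
     regular_closed_curve \<gamma> \<and> enclosed_area \<gamma> > 0 \<and> curvature_osc h \<gamma> < \<epsilon> \<and>
     isoperimetric_ratio h \<gamma> < exp (\<epsilon> / (8 * (enclosed_area (isoperimetrix h))\<^sup>2))"

definition stability_property :: "(real \<Rightarrow> real) \<Rightarrow> nat \<Rightarrow> real \<Rightarrow> bool" where
  "stability_property h p \<epsilon> \<longleftrightarrow>
     (\<forall>\<gamma>\<^sub>0. almost_isoperimetric h \<epsilon> \<gamma>\<^sub>0 \<longrightarrow>
        (\<exists>\<Gamma>. polyharmonic_flow h p \<infinity> \<Gamma> \<and> \<Gamma> 0 = \<gamma>\<^sub>0) \<and>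
        (\<forall>T \<Gamma>. maximal_polyharmonic_flow h p T \<Gamma> \<and> \<Gamma> 0 = \<gamma>\<^sub>0 \<longrightarrow>
           T = \<infinity> \<and>
           (\<exists>x\<^sub>0 :: complex. \<exists>l>0.
              enclosed_area (\<lambda>\<theta>. x\<^sub>0 + l *\<^sub>R isoperimetrix h \<theta>) = enclosed_area \<gamma>\<^sub>0 \<and>
              converges_exponentially \<Gamma> (\<lambda>\<theta>. x\<^sub>0 + l *\<^sub>R isoperimetrix h \<theta>)) \<and>
           (\<forall>m\<ge>1. \<exists>C. \<exists>\<delta>>0. \<forall>\<^sub>F t in at_top.
              mink_integral h (\<Gamma> t) (\<lambda>u. (mink_curvature_deriv h (\<Gamma> t) m u)\<^sup>2)
                \<le> C * exp (- \<delta> * t))))"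

end

theory Submission
  imports Defs
begin

text \<open>
  Write \<open>L\<close> for the Minkowski length, \<open>F\<close> for the normal speed of the flow, \<open>A\<close> for the area of the
  isoperimetrix and \<open>A\<^sub>0\<close> for that of the initial curve. The idea is that a curve whose curvature vanishes
  somewhere loses length at a definite rate, while the total loss of length is limited by the
  isoperimetric ratio.

  The first variation of length is \<open>- \<integral> F \<kappa> d\<sigma>\<close>, and \<open>p\<close> integrations by parts turn it into
  \<open>L' = - \<integral> (\<kappa>\<^sub>\<sigma>\<^sup>p)\<^sup>2 d\<sigma>\<close> (\<open>length_decay\<close>). The total curvature \<open>\<integral> \<kappa> d\<sigma>\<close> does not change in
  time (\<open>total_curvature_constant\<close>), and it equals \<open>2 A\<close> because the flow converges to a homothetic
  copy of the isoperimetrix. As it is positive, \<open>\<kappa>\<close> has a zero as soon as it is not positive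
  everywhere. At such a time the Wirtinger inequality for functions with a zero bounds \<open>\<integral> \<kappa>\<^sup>2 d\<sigma>\<close> by
  \<open>(L / \<pi>)\<^sup>2 \<integral> \<kappa>\<^sub>\<sigma>\<^sup>2 d\<sigma>\<close>; each further derivative costs a factor \<open>(L / 2\<pi>)\<^sup>2\<close> since the
  derivatives of \<open>\<kappa>\<close> have mean zero. With the Cauchy-Schwarz inequality \<open>(2 A)\<^sup>2 \<le> L \<integral> \<kappa>\<^sup>2 d\<sigma>\<close> this
  gives \<open>4\<^sup>p \<pi>\<^sup>2\<^sup>p A\<^sup>2 \<le> - L\<^sup>2\<^sup>p\<^sup>+\<^sup>1 L'\<close> (\<open>curvature_energy_lower_bound\<close>).

  Hence \<open>L\<^sup>2\<^sup>p\<^sup>+\<^sup>2\<close>, which never increases, falls at least at the constant rate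
  \<open>(2 p + 2) 4\<^sup>p \<pi>\<^sup>2\<^sup>p A\<^sup>2\<close> while the curve is not convex. It starts at
  \<open>(4 A\<^sub>0 A)\<^sup>p\<^sup>+\<^sup>1 I\<^sup>p\<^sup>+\<^sup>1\<close>, with \<open>I\<close> the initial isoperimetric ratio, and tends to
  \<open>(4 A\<^sub>0 A)\<^sup>p\<^sup>+\<^sup>1\<close>, the value of the limit curve, whose area is \<open>A\<^sub>0\<close>. Dividing the difference by
  the rate bounds the measure of the set of these times.

  A curve enters the argument only through its velocity \<open>z\<close>: the tangent turns at the rate
  \<open>Im (z' / z)\<close>, and a \<open>2\<pi>\<close>-periodic function of the tangent angle is a function of the direction of
  \<open>z\<close>. So all quantities depend smoothly on time and parameter jointly, although the tangent angle is
  chosen for each curve separately.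
\<close>

section \<open>Smooth functions of a real variable\<close>

lemma has_vector_derivative_vderiv:
  "f differentiable (at u) \<Longrightarrow> (f has_vector_derivative vderiv f u) (at u)"
  by (simp add: vderiv_def vector_derivative_works)

lemma vderiv_eqI: "(f has_vector_derivative f') (at u) \<Longrightarrow> vderiv f u = f'"
  by (simp add: vderiv_def vector_derivative_at)

lemma differentiable_if_has_vector_derivative:
  "(f has_vector_derivative f') (at u) \<Longrightarrow> f differentiable (at u)"
  by (auto simp: has_vector_derivative_def differentiable_def)

text \<open>
  Closure properties of smoothness are proved for finitely many derivatives, by induction on
  their number: the derivative of a product or a quotient is built from functions of the same kind.
\<close>

definition times_differentiable :: "nat \<Rightarrow> (real \<Rightarrow> 'a::real_normed_vector) \<Rightarrow> bool" where
  "times_differentiable n f \<longleftrightarrow> (\<forall>m<n. \<forall>u. (vderiv ^^ m) f differentiable (at u))"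

lemma smooth_fun_iff_times_differentiable: "smooth_fun f \<longleftrightarrow> (\<forall>n. times_differentiable n f)"
  by (auto simp: smooth_fun_def times_differentiable_def)

lemma times_differentiable_0 [simp]: "times_differentiable 0 f"
  by (simp add: times_differentiable_def)

lemma times_differentiable_Suc:
  "times_differentiable (Suc n) f \<longleftrightarrow> (\<forall>u. f differentiable (at u)) \<and> times_differentiable n (vderiv f)"
  unfolding times_differentiable_def
  by (subst All_less_Suc2) (simp add: funpow_Suc_right del: funpow.simps(2))

lemma times_differentiable_mono: "times_differentiable n f \<Longrightarrow> m \<le> n \<Longrightarrow> times_differentiable m f"
  by (auto simp: times_differentiable_def)

lemma times_differentiable_SucI:
  assumes "\<And>u. (f has_vector_derivative f' u) (at u)" and "times_differentiable n f'"
  shows "times_differentiable (Suc n) f"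
proof -
  have "vderiv f = f'" using assms(1) by (auto intro: vderiv_eqI)
  then show ?thesis
    using assms by (auto simp: times_differentiable_Suc intro: differentiable_if_has_vector_derivative)
qed

lemma times_differentiable_SucD:
  assumes "times_differentiable (Suc n) f"
  shows "(f has_vector_derivative vderiv f u) (at u)" "times_differentiable n (vderiv f)"
    "times_differentiable n f"
  using assms times_differentiable_mono[OF assms, of n]
  by (auto simp: times_differentiable_Suc intro: has_vector_derivative_vderiv)

lemma times_differentiable_const: "times_differentiable n (\<lambda>_. c)"
proof (induction n arbitrary: c)
  case (Suc n)
  show ?case by (rule times_differentiable_SucI[OF _ Suc]) (rule has_vector_derivative_const)
qed simp

lemma times_differentiable_add:
  "times_differentiable n f \<Longrightarrow> times_differentiable n g \<Longrightarrow> times_differentiable n (\<lambda>u. f u + g u)"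
proof (induction n arbitrary: f g)
  case (Suc n)
  note f = times_differentiable_SucD[OF Suc.prems(1)] and g = times_differentiable_SucD[OF Suc.prems(2)]
  show ?case
    by (rule times_differentiable_SucI[OF has_vector_derivative_add[OF f(1) g(1)]]) (intro Suc.IH f g)
qed simp

lemma times_differentiable_mult:
  fixes f g :: "real \<Rightarrow> 'a::real_normed_algebra"
  shows "times_differentiable n f \<Longrightarrow> times_differentiable n g \<Longrightarrow> times_differentiable n (\<lambda>u. f u * g u)"
proof (induction n arbitrary: f g)
  case (Suc n)
  note f = times_differentiable_SucD[OF Suc.prems(1)] and g = times_differentiable_SucD[OF Suc.prems(2)]
  show ?case
    by (rule times_differentiable_SucI[OF has_vector_derivative_mult[OF f(1) g(1)]])
      (intro times_differentiable_add Suc.IH f g)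
qed simp

lemma times_differentiable_linear:
  assumes "bounded_linear l"
  shows "times_differentiable n f \<Longrightarrow> times_differentiable n (\<lambda>u. l (f u))"
proof (induction n arbitrary: f)
  case (Suc n)
  note f = times_differentiable_SucD[OF Suc.prems]
  show ?case
    by (rule times_differentiable_SucI[OF bounded_linear.has_vector_derivative[OF assms f(1)]])
      (intro Suc.IH f)
qed simp

lemma has_vector_derivative_inverse:
  fixes f :: "real \<Rightarrow> 'a::real_normed_field"
  assumes "(f has_vector_derivative f') (at u within S)" and "f u \<noteq> 0"
  shows "((\<lambda>u. inverse (f u)) has_vector_derivative - (f' * (inverse (f u) * inverse (f u))))
    (at u within S)"
  using vector_derivative_diff_chain_within[OF assms(1), of inverse]
    has_derivative_inverse'[OF assms(2)]
  by (auto simp: o_def has_derivative_at_withinI mult_ac)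

lemma times_differentiable_inverse:
  fixes f :: "real \<Rightarrow> 'a::real_normed_field"
  shows "times_differentiable n f \<Longrightarrow> (\<forall>u. f u \<noteq> 0) \<Longrightarrow> times_differentiable n (\<lambda>u. inverse (f u))"
proof (induction n arbitrary: f)
  case (Suc n)
  note f = times_differentiable_SucD[OF Suc.prems(1)]
  show ?case
    by (rule times_differentiable_SucI[OF has_vector_derivative_inverse[OF f(1)]])
      (use Suc f in \<open>auto intro!: times_differentiable_linear[OF bounded_linear_minus[OF bounded_linear_ident]]
         times_differentiable_mult\<close>)
qed simp

lemma times_differentiable_divide:
  fixes f g :: "real \<Rightarrow> 'a::real_normed_field"
  assumes "times_differentiable n f" "times_differentiable n g" "\<forall>u. g u \<noteq> 0"
  shows "times_differentiable n (\<lambda>u. f u / g u)"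
  unfolding divide_inverse
  by (intro times_differentiable_mult times_differentiable_inverse assms)

lemma smooth_fun_SucD:
  assumes "smooth_fun f"
  shows "(f has_vector_derivative vderiv f u) (at u)" "smooth_fun (vderiv f)"
proof -
  have "times_differentiable (Suc n) f" for n
    using assms by (simp add: smooth_fun_iff_times_differentiable)
  note s = times_differentiable_SucD[OF this]
  show "(f has_vector_derivative vderiv f u) (at u)" by (rule s(1))
  show "smooth_fun (vderiv f)" using s(2) by (simp add: smooth_fun_iff_times_differentiable)
qed

lemma smooth_fun_continuous: "smooth_fun f \<Longrightarrow> continuous_on S f"
  by (meson continuous_at_imp_continuous_on has_vector_derivative_continuous smooth_fun_SucD(1))

lemma smooth_funI: 
  assumes "\<And>u. (f has_vector_derivative f' u) (at u)" and "smooth_fun f'"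
  shows "smooth_fun f"
proof -
  have "times_differentiable n f" for n
    using times_differentiable_SucI[OF assms(1), of n] assms(2)
    by (auto simp: smooth_fun_iff_times_differentiable intro: times_differentiable_mono)
  then show ?thesis by (simp add: smooth_fun_iff_times_differentiable)
qed

lemma smooth_fun_const: "smooth_fun (\<lambda>_. c)"
  by (simp add: smooth_fun_iff_times_differentiable times_differentiable_const)

lemma smooth_fun_add: "smooth_fun f \<Longrightarrow> smooth_fun g \<Longrightarrow> smooth_fun (\<lambda>u. f u + g u)"
  by (simp add: smooth_fun_iff_times_differentiable times_differentiable_add)

lemma smooth_fun_mult:
  fixes f g :: "real \<Rightarrow> 'a::real_normed_algebra"
  shows "smooth_fun f \<Longrightarrow> smooth_fun g \<Longrightarrow> smooth_fun (\<lambda>u. f u * g u)"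
  by (simp add: smooth_fun_iff_times_differentiable times_differentiable_mult)

lemma smooth_fun_divide:
  fixes f g :: "real \<Rightarrow> 'a::real_normed_field"
  shows "smooth_fun f \<Longrightarrow> smooth_fun g \<Longrightarrow> \<forall>u. g u \<noteq> 0 \<Longrightarrow> smooth_fun (\<lambda>u. f u / g u)"
  by (simp add: smooth_fun_iff_times_differentiable times_differentiable_divide)

lemma smooth_fun_linear: "bounded_linear l \<Longrightarrow> smooth_fun f \<Longrightarrow> smooth_fun (\<lambda>u. l (f u))"
  by (simp add: smooth_fun_iff_times_differentiable times_differentiable_linear)

lemma vderiv_periodic:
  assumes per: "\<forall>u. f (u + P) = f u" and d: "\<And>u. (f has_vector_derivative vderiv f u) (at u)"
  shows "vderiv f (u + P) = vderiv f u"
proof -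
  have "((f \<circ> (\<lambda>v. v + P)) has_vector_derivative 1 *\<^sub>R vderiv f (u + P)) (at u)"
    by (rule vector_diff_chain_at) (auto intro!: derivative_eq_intros d)
  moreover have "f \<circ> (\<lambda>v. v + P) = f" using per by auto
  ultimately show ?thesis using vderiv_eqI by (metis scaleR_one)
qed

lemma has_vector_derivative_cis: "(cis has_vector_derivative \<i> * cis u) (at u)"
proof -
  have "((\<lambda>u. \<i> * of_real u :: complex) has_vector_derivative \<i> * 1) (at u)"
    by (intro derivative_intros) (auto intro!: derivative_eq_intros)
  from field_vector_diff_chain_at[OF this DERIV_exp] show ?thesis
    by (simp add: o_def cis_conv_exp[abs_def])
qed

lemma smooth_fun_of_real: "smooth_fun f \<Longrightarrow> smooth_fun (\<lambda>u. complex_of_real (f u))"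
  by (rule smooth_fun_linear[OF bounded_linear_of_real])

lemma has_vector_derivative_of_real_vderiv:
  "smooth_fun f \<Longrightarrow> ((\<lambda>u. complex_of_real (f u)) has_vector_derivative of_real (vderiv f u)) (at u)"
  by (rule bounded_linear.has_vector_derivative[OF bounded_linear_of_real smooth_fun_SucD(1)])

lemma smooth_fun_cis: "smooth_fun cis"
proof -
  have "times_differentiable n cis" for n
  proof (induction n)
    case (Suc n)
    then show ?case
      by (intro times_differentiable_SucI[OF has_vector_derivative_cis]
          times_differentiable_mult times_differentiable_const)
  qed simp
  then show ?thesis by (simp add: smooth_fun_iff_times_differentiable)
qed

section \<open>Functions of the direction of a plane vector\<close>

text \<open>
  A \<open>2\<pi>\<close>-periodic function of the angle, viewed as a function of nonzero vectors that depends only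
  on the direction. In this form no continuous choice of the tangent angle is needed: every quantity
  attached to a curve becomes an expression in its velocity \<open>z\<close>.
\<close>

definition angular :: "(real \<Rightarrow> 'a) \<Rightarrow> complex \<Rightarrow> 'a" where
  "angular q z = q (Arg z)"

lemma periodic_add_int:
  assumes "\<forall>x. q (x + P) = q x"
  shows "q (x + P * of_int n) = q (x::real)"
proof -
  have nat: "q (x + P * real k) = q x" for x k
  proof (induction k arbitrary: x)
    case (Suc k)
    have "q (x + P * real (Suc k)) = q (x + P + P * real k)" by (simp add: algebra_simps)
    then show ?case using Suc[of "x + P"] assms by simp
  qed simp
  show ?thesis
  proof (cases "n \<ge> 0")
    case True
    then show ?thesis using nat[of x "nat n"] by simp
  next
    case False
    then show ?thesis using nat[of "x + P * of_int n" "nat (- n)"] by simp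
  qed
qed

lemma periodic_representative:
  assumes "\<forall>x. f (x + 2 * pi) = f x"
  shows "\<exists>v\<in>{0..2 * pi}. f v = f (u::real)"
proof -
  define n where "n = - \<lfloor>u / (2 * pi)\<rfloor>"
  define v where "v = u + 2 * pi * of_int n"
  have "v \<in> {0..2 * pi}"
    using floor_divide_lower[of "2 * pi" u] floor_divide_upper[of "2 * pi" u]
    by (simp add: v_def n_def algebra_simps)
  then show ?thesis using periodic_add_int[OF assms, of u n] v_def by metis
qed

lemma angular_eqI:
  assumes "\<forall>x. q (x + 2 * pi) = q x" and "sgn z = cis a" and "z \<noteq> 0"
  shows "angular q z = q a"
proof -
  have "cis (Arg z) = cis a" using assms cis_Arg by simp
  then obtain n :: int where "Arg z = a + 2 * pi * n"
    using sin_cos_eq_iff by (auto simp: complex_eq_iff)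
  then show ?thesis using periodic_add_int[OF assms(1)] by (simp add: angular_def)
qed

lemma angular_cis: "\<forall>x. q (x + 2 * pi) = q x \<Longrightarrow> c > 0 \<Longrightarrow> angular q (of_real c * cis a) = q a"
  by (rule angular_eqI) (auto simp: sgn_mult sgn_of_real)

text \<open>
  Near \<open>z\<^sub>0\<close> the angle may be measured from the direction of \<open>z\<^sub>0\<close>, which keeps the branch cut of the
  logarithm away from \<open>z / z\<^sub>0\<close>, a number close to 1.
\<close>

lemma has_derivative_angular:
  assumes per: "\<forall>x. q (x + 2 * pi) = q x" and d: "\<And>x. (q has_vector_derivative q' x) (at x)"
    and z0: "z0 \<noteq> (0::complex)"
  shows "(angular q has_derivative (\<lambda>w. Im (w / z0) *\<^sub>R angular q' z0)) (at z0)"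
proof -
  define g where "g z = q (Arg z0 + Im (Ln (z / z0)))" for z
  have eq: "angular q z = g z" if "z \<noteq> 0" for z
    unfolding g_def
  proof (rule angular_eqI[OF per _ that])
    have "cis (Im (Ln (z / z0))) = sgn (z / z0)"
      using that z0 by (metis Arg_eq_Im_Ln cis_Arg divide_eq_0_iff)
    then show "sgn z = cis (Arg z0 + Im (Ln (z / z0)))"
      using that z0 by (simp add: cis_Arg sgn_divide sgn_eq_0_iff flip: cis_mult)
  qed
  have "((\<lambda>z. Ln (z / z0)) has_field_derivative 1 / z0) (at z0)"
    using z0 by (auto intro!: derivative_eq_intros)
  then have "((\<lambda>z. Ln (z / z0)) has_derivative (\<lambda>w. w / z0)) (at z0)"
    by (simp add: has_field_derivative_def times_divide_eq_left[abs_def])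
  from has_derivative_add[OF has_derivative_const has_derivative_Im[OF this]]
  have l: "((\<lambda>z. Arg z0 + Im (Ln (z / z0))) has_derivative (\<lambda>w. Im (w / z0))) (at z0)"
    by simp
  have "(q has_derivative (\<lambda>x. x *\<^sub>R q' (Arg z0))) (at (Arg z0 + Im (Ln (z0 / z0))))"
    using d[of "Arg z0"] z0 by (simp add: has_vector_derivative_def)
  from has_derivative_compose[OF l this]
  have "(g has_derivative (\<lambda>w. Im (w / z0) *\<^sub>R angular q' z0)) (at z0)"
    by (simp add: g_def[abs_def] angular_def)
  then show ?thesis
    by (rule has_derivative_transform_within_open[where s = "- {0}"]) (auto simp: eq z0)
qed

lemma has_vector_derivative_angular:
  fixes z :: "real \<Rightarrow> complex"
  assumes "\<forall>x. q (x + 2 * pi) = q x" and "\<And>x. (q has_vector_derivative q' x) (at x)"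
    and "(z has_vector_derivative z') (at u within S)" and "z u \<noteq> 0"
  shows "((\<lambda>u. angular q (z u)) has_vector_derivative Im (z' / z u) *\<^sub>R angular q' (z u)) (at u within S)"
  using vector_derivative_diff_chain_within[OF assms(3)
      has_derivative_at_withinI[OF has_derivative_angular[OF assms(1,2,4)]]]
  by (simp add: o_def)

lemma continuous_on_angular:
  assumes "\<forall>x. q (x + 2 * pi) = q x" and "\<And>x. (q has_vector_derivative q' x) (at x)"
    and "continuous_on S f" and "\<And>x. x \<in> S \<Longrightarrow> f x \<noteq> 0"
  shows "continuous_on S (\<lambda>x. angular q (f x))"
proof (rule continuous_on_compose2[OF _ assms(3), where t = "- {0}" and g = "angular q"])
  show "continuous_on (- {0}) (angular q)"
    using has_derivative_angular[OF assms(1,2)]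
    by (intro continuous_at_imp_continuous_on) (auto intro: has_derivative_continuous)
qed (use assms(4) in auto)

lemma has_vector_derivative_norm:
  fixes z :: "real \<Rightarrow> complex"
  assumes "(z has_vector_derivative z') (at u within S)" and "z u \<noteq> 0"
  shows "((\<lambda>u. norm (z u)) has_vector_derivative norm (z u) * Re (z' / z u)) (at u within S)"
proof -
  have "Re (z' / z u) = (z' \<bullet> z u) / (norm (z u))\<^sup>2"
    by (simp add: inner_complex_def Re_divide flip: cmod_power2)
  then have "z' \<bullet> sgn (z u) = norm (z u) * Re (z' / z u)"
    using assms(2) by (simp add: sgn_div_norm power2_eq_square field_simps)
  then show ?thesis
    using vector_derivative_diff_chain_within[OF assms(1)
        has_derivative_at_withinI[OF has_derivative_norm[OF assms(2)]]]
    by (simp add: o_def)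
qed

lemma smooth_fun_norm:
  fixes z :: "real \<Rightarrow> complex"
  assumes z: "smooth_fun z" and nz: "\<forall>u. z u \<noteq> 0"
  shows "smooth_fun (\<lambda>u. norm (z u))"
proof -
  note d = smooth_fun_SucD[OF z]
  have "times_differentiable n (\<lambda>u. norm (z u))" for n
  proof (induction n)
    case (Suc n)
    have "times_differentiable n (\<lambda>u. Re (vderiv z u / z u))"
      using smooth_fun_linear[OF bounded_linear_Re smooth_fun_divide[OF d(2) z nz]]
      by (simp add: smooth_fun_iff_times_differentiable)
    then show ?case
      using nz by (intro times_differentiable_SucI[OF has_vector_derivative_norm[OF d(1)]]
          times_differentiable_mult Suc) auto
  qed simp
  then show ?thesis by (simp add: smooth_fun_iff_times_differentiable)
qed

lemma smooth_fun_angular: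
  fixes z :: "real \<Rightarrow> complex" and q :: "real \<Rightarrow> real"
  assumes z: "smooth_fun z" and nz: "\<forall>u. z u \<noteq> 0"
    and "smooth_fun q" and "\<forall>x. q (x + 2 * pi) = q x"
  shows "smooth_fun (\<lambda>u. angular q (z u))"
proof -
  note d = smooth_fun_SucD[OF z]
  have "times_differentiable n (\<lambda>u. angular q (z u))"
    if "smooth_fun q" "\<forall>x. q (x + 2 * pi) = q x" for n and q :: "real \<Rightarrow> real"
    using that
  proof (induction n arbitrary: q)
    case (Suc n)
    note q = smooth_fun_SucD[OF Suc.prems(1)]
    have "times_differentiable n (\<lambda>u. Im (vderiv z u / z u))"
      using smooth_fun_linear[OF bounded_linear_Im smooth_fun_divide[OF d(2) z nz]]
      by (simp add: smooth_fun_iff_times_differentiable)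
    moreover have "times_differentiable n (\<lambda>u. angular (vderiv q) (z u))"
      by (intro Suc.IH q allI vderiv_periodic Suc.prems)
    ultimately show ?case
      using nz Suc.prems
      by (intro times_differentiable_SucI[OF has_vector_derivative_angular[OF _ q(1) d(1)]])
        (auto intro: times_differentiable_mult simp: real_scaleR_def)
  qed simp
  then show ?thesis using assms by (simp add: smooth_fun_iff_times_differentiable)
qed

section \<open>Integrals of periodic functions\<close>

lemma antiderivative_exists:
  fixes f :: "real \<Rightarrow> 'a::euclidean_space"
  assumes "continuous_on UNIV f"
  obtains F where "\<And>x. (F has_vector_derivative f x) (at x)"
  using einterval_antiderivative[of "-\<infinity>" "\<infinity>" f] assms
  by (auto simp: continuous_on_eq_continuous_at)

lemma integral_eq_diff:
  fixes F :: "real \<Rightarrow> 'a::euclidean_space"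
  assumes "\<And>x. (F has_vector_derivative f x) (at x)" and "a \<le> b"
  shows "integral {a..b} f = F b - F a"
  using assms by (intro integral_unique fundamental_theorem_of_calculus)
    (auto intro: has_vector_derivative_at_within)

lemma integral_periodic_derivative:
  fixes F :: "real \<Rightarrow> 'a::euclidean_space"
  assumes "\<And>x. (F has_vector_derivative f x) (at x)" and "\<And>x. F (x + P) = F x" and "P \<ge> 0"
  shows "integral {0..P} f = 0"
  using integral_eq_diff[OF assms(1) assms(3)] assms(2)[of 0] by simp

text \<open>
  An antiderivative of a periodic function grows by the same amount over every period. So only the
  displacement of \<open>\<phi>\<close> between the end points matters, not where the period starts.
\<close>

lemma integral_periodic_substitution:
  fixes g :: "real \<Rightarrow> real" and \<phi> :: "real \<Rightarrow> real"
  assumes g: "continuous_on UNIV g" "\<And>x. g (x + P) = g x" and "P \<ge> 0"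
    and \<phi>: "\<And>x. (\<phi> has_vector_derivative \<phi>' x) (at x)" "\<phi> (a + P) = \<phi> a + P"
  shows "integral {a..a + P} (\<lambda>x. \<phi>' x * g (\<phi> x)) = integral {0..P} g"
proof -
  obtain G where G: "\<And>x. (G has_vector_derivative g x) (at x)"
    using antiderivative_exists[OF g(1)] by blast
  have c: "((\<lambda>x. G (\<phi> x)) has_vector_derivative \<phi>' x * g (\<phi> x)) (at x)" for x
    using vector_diff_chain_at[OF \<phi>(1) G] by (simp add: o_def)
  have "((\<lambda>x. G (x + P) - G x) has_vector_derivative 0) (at x)" for x
  proof -
    have "((G \<circ> (\<lambda>x. x + P)) has_vector_derivative 1 *\<^sub>R g (x + P)) (at x)"
      by (rule vector_diff_chain_at[OF _ G]) (auto intro!: derivative_eq_intros)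
    then have "((\<lambda>x. G (x + P)) has_vector_derivative g x) (at x)"
      by (simp add: o_def g(2))
    from has_vector_derivative_diff[OF this G] show ?thesis by simp
  qed
  then obtain c where "\<And>x. G (x + P) - G x = c"
    using has_vector_derivative_zero_constant[of UNIV "\<lambda>x. G (x + P) - G x"] by auto
  from this[of "\<phi> a"] this[of 0] have "G (\<phi> a + P) - G (\<phi> a) = G P - G 0" by simp
  moreover have "integral {a..a + P} (\<lambda>x. \<phi>' x * g (\<phi> x)) = G (\<phi> (a + P)) - G (\<phi> a)"
    using integral_eq_diff[OF c] assms(3) by simp
  ultimately show ?thesis using integral_eq_diff[OF G assms(3)] \<phi>(2) by simp
qed

lemma integral_periodic_shift:
  fixes g :: "real \<Rightarrow> real"
  assumes "continuous_on UNIV g" "\<And>x. g (x + P) = g x" and "P \<ge> 0"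
  shows "integral {a..a + P} g = integral {0..P} g"
  using integral_periodic_substitution[OF assms, of "\<lambda>x. x" "\<lambda>_. 1"]
  by (auto intro!: derivative_eq_intros)

section \<open>The geometry of a curve in terms of its velocity\<close>

lemma unit_tangent_eq_sgn: "unit_tangent \<gamma> u = sgn (vderiv \<gamma> u)"
  by (simp add: unit_tangent_def arc_deriv_def curve_speed_def sgn_div_norm)

text \<open>
  The logarithmic derivative \<open>z' / z\<close> of the velocity has an antiderivative \<open>F\<close>; then \<open>z exp (- F)\<close> is
  constant, so \<open>F\<close> is a logarithm of \<open>z\<close> up to a constant and its imaginary part measures the angle.
\<close>

lemma tangent_angle_exists:
  assumes "smooth_fun \<gamma>" and nz: "\<forall>u. vderiv \<gamma> u \<noteq> 0"
  shows "\<exists>\<theta>. (\<forall>u. \<theta> differentiable (at u)) \<and> (\<forall>u. unit_tangent \<gamma> u = cis (\<theta> u))"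
proof -
  define z where "z = vderiv \<gamma>"
  have z: "smooth_fun z" using smooth_fun_SucD[OF assms(1)] by (simp add: z_def)
  have z0: "\<forall>u. z u \<noteq> 0" using nz by (simp add: z_def)
  note dz = smooth_fun_SucD[OF z]
  obtain F where F: "\<And>x. (F has_vector_derivative vderiv z x / z x) (at x)"
    using antiderivative_exists[OF smooth_fun_continuous[OF smooth_fun_divide[OF dz(2) z z0]]] by blast
  have "((\<lambda>x. z x * exp (- F x)) has_vector_derivative 0) (at x)" for x
  proof -
    have "((exp \<circ> (\<lambda>x. - F x)) has_vector_derivative (- (vderiv z x / z x)) * exp (- F x)) (at x)"
      by (intro field_vector_diff_chain_at has_vector_derivative_minus F DERIV_exp)
    from has_vector_derivative_mult[OF dz(1) this] show ?thesis
      using z0 by (simp add: o_def)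
  qed
  then obtain c where c: "\<And>x. z x * exp (- F x) = c"
    using has_vector_derivative_zero_constant[of UNIV "\<lambda>x. z x * exp (- F x)"] by auto
  have zc: "z x = c * exp (F x)" for x
    using c[of x] by (simp add: exp_minus field_simps)
  have c0: "c \<noteq> 0" using z0 zc[of 0] by auto
  have "sgn (exp (F x)) = cis (Im (F x))" for x
    by (simp add: exp_eq_polar sgn_mult sgn_of_real)
  then have "unit_tangent \<gamma> u = cis (Arg c + Im (F u))" for u
    using c0 zc[of u] by (simp add: unit_tangent_eq_sgn sgn_mult cis_Arg z_def flip: cis_mult)
  moreover have "(\<lambda>u. Arg c + Im (F u)) differentiable (at u)" for u
    using has_vector_derivative_add[OF has_vector_derivative_const
        bounded_linear.has_vector_derivative[OF bounded_linear_Im F]]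
    by (rule differentiable_if_has_vector_derivative)
  ultimately show ?thesis by blast
qed

lemma
  assumes "smooth_fun \<gamma>" and "\<forall>u. vderiv \<gamma> u \<noteq> 0"
  shows differentiable_tangent_angle: "tangent_angle \<gamma> differentiable (at u)"
    and sgn_velocity_eq_cis: "sgn (vderiv \<gamma> u) = cis (tangent_angle \<gamma> u)"
proof -
  have "(\<forall>u. tangent_angle \<gamma> differentiable (at u)) \<and> (\<forall>u. unit_tangent \<gamma> u = cis (tangent_angle \<gamma> u))"
    unfolding tangent_angle_def by (rule someI_ex[OF tangent_angle_exists[OF assms]])
  then show "tangent_angle \<gamma> differentiable (at u)" "sgn (vderiv \<gamma> u) = cis (tangent_angle \<gamma> u)"
    unfolding unit_tangent_eq_sgn by blast+
qed

text \<open>A tangent angle is determined up to multiples of \<open>2\<pi>\<close>, which \<open>q\<close> does not see.\<close>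

lemma periodic_tangent_angle:
  assumes "smooth_fun \<gamma>" and "\<forall>u. vderiv \<gamma> u \<noteq> 0" and "\<forall>x. q (x + 2 * pi) = q x"
  shows "q (tangent_angle \<gamma> u) = angular q (vderiv \<gamma> u)"
  using angular_eqI[OF assms(3) sgn_velocity_eq_cis[OF assms(1,2)]] assms(2) by metis

text \<open>Differentiating \<open>z = \<bar>z\<bar> cis \<theta>\<close> identifies \<open>\<theta>\<^sub>u\<close> as the imaginary part of \<open>z' / z\<close>.\<close>

lemma euclidean_curvature_eq:
  assumes "smooth_fun \<gamma>" and nz: "\<forall>u. vderiv \<gamma> u \<noteq> 0"
  shows "euclidean_curvature \<gamma> u = Im (vderiv (vderiv \<gamma>) u / vderiv \<gamma> u) / norm (vderiv \<gamma> u)"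
proof -
  define z where "z = vderiv \<gamma>"
  define \<theta> where "\<theta> = tangent_angle \<gamma>"
  have dz: "(z has_vector_derivative vderiv z u) (at u)"
    unfolding z_def by (rule smooth_fun_SucD(1)[OF smooth_fun_SucD(2)[OF assms(1)]])
  have z0: "z u \<noteq> 0" using nz by (simp add: z_def)
  have d\<theta>: "(\<theta> has_vector_derivative vderiv \<theta> u) (at u)"
    using differentiable_tangent_angle[OF assms] by (simp add: \<theta>_def has_vector_derivative_vderiv)
  have dc: "((\<lambda>u. cis (\<theta> u)) has_vector_derivative \<i> * of_real (vderiv \<theta> u) * cis (\<theta> u)) (at u)"
  proof -
    have "((\<lambda>u. \<i> * of_real (\<theta> u)) has_vector_derivative \<i> * of_real (vderiv \<theta> u)) (at u)"
      using d\<theta> by (auto intro!: derivative_eq_intros simp: has_real_derivative_iff_has_vector_derivative)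
    from field_vector_diff_chain_at[OF this DERIV_exp] show ?thesis
      by (simp add: o_def cis_conv_exp)
  qed
  have pol: "z v = of_real (norm (z v)) * cis (\<theta> v)" for v
    using nz by (simp add: z_def \<theta>_def sgn_eq flip: sgn_velocity_eq_cis[OF assms])
  define \<rho> where "\<rho> = Re (vderiv z u / z u)"
  have "((\<lambda>u. of_real (norm (z u)) :: complex) has_vector_derivative of_real (norm (z u) * \<rho>)) (at u)"
    unfolding \<rho>_def using has_vector_derivative_norm[OF dz z0]
    by (auto intro!: derivative_eq_intros simp: has_real_derivative_iff_has_vector_derivative)
  from has_vector_derivative_mult[OF this dc]
  have "(z has_vector_derivative of_real (norm (z u)) * (\<i> * of_real (vderiv \<theta> u) * cis (\<theta> u))
      + of_real (norm (z u) * \<rho>) * cis (\<theta> u)) (at u)"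
    by (simp flip: pol)
  from vderiv_eqI[OF this]
  have "vderiv z u = (of_real (norm (z u)) * cis (\<theta> u)) * (\<i> * of_real (vderiv \<theta> u) + of_real \<rho>)"
    by (simp add: algebra_simps)
  then have "vderiv z u / z u = \<i> * of_real (vderiv \<theta> u) + of_real \<rho>"
    using z0 by (simp add: flip: pol)
  then have "Im (vderiv z u / z u) = vderiv \<theta> u"
    by (simp add: complex_eq_iff)
  then show ?thesis
    by (simp add: euclidean_curvature_def arc_deriv_def curve_speed_def z_def \<theta>_def divide_inverse mult.commute)
qed

lemma enclosed_area_eq:
  "enclosed_area \<gamma> = - (1 / 2) * integral {0..2 * pi} (\<lambda>u. \<gamma> u \<bullet> (\<i> * vderiv \<gamma> u))"
proof -
  have "(\<gamma> u \<bullet> unit_normal \<gamma> u) * curve_speed \<gamma> u = \<gamma> u \<bullet> (\<i> * vderiv \<gamma> u)" for u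
    by (cases "vderiv \<gamma> u = 0")
      (simp_all add: unit_normal_def unit_tangent_eq_sgn curve_speed_def sgn_div_norm)
  then show ?thesis by (simp add: enclosed_area_def)
qed

section \<open>Calculus along a closed curve in a Minkowski plane\<close>

text \<open>
  The one-homogeneous extension of \<open>h\<close>: the Minkowski length element of a curve with velocity \<open>z\<close> is
  \<open>mink_norm h z du\<close>.
\<close>

definition mink_norm :: "(real \<Rightarrow> real) \<Rightarrow> complex \<Rightarrow> real" where
  "mink_norm h z = norm z * angular h z"

definition smooth_periodic :: "(real \<Rightarrow> 'a::real_normed_vector) \<Rightarrow> bool" where
  "smooth_periodic f \<longleftrightarrow> smooth_fun f \<and> (\<forall>u. f (u + 2 * pi) = f u)"

lemma smooth_periodic_vderiv: "smooth_periodic f \<Longrightarrow> smooth_periodic (vderiv f)"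
  by (auto simp: smooth_periodic_def intro: vderiv_periodic smooth_fun_SucD)

lemma smooth_periodic_continuous: "smooth_periodic f \<Longrightarrow> continuous_on S f"
  by (simp add: smooth_periodic_def smooth_fun_continuous)

lemma smooth_periodic_has_vector_derivative:
  "smooth_periodic f \<Longrightarrow> (f has_vector_derivative vderiv f u) (at u)"
  by (simp add: smooth_periodic_def smooth_fun_SucD)

lemma smooth_periodic_mult:
  fixes f g :: "real \<Rightarrow> 'a::real_normed_algebra"
  shows "smooth_periodic f \<Longrightarrow> smooth_periodic g \<Longrightarrow> smooth_periodic (\<lambda>u. f u * g u)"
  by (simp add: smooth_periodic_def smooth_fun_mult)

lemma smooth_periodic_power2:
  fixes f :: "real \<Rightarrow> real"
  shows "smooth_periodic f \<Longrightarrow> smooth_periodic (\<lambda>u. (f u)\<^sup>2)"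
  unfolding power2_eq_square by (rule smooth_periodic_mult)

lemma smooth_periodic_divide:
  fixes f g :: "real \<Rightarrow> 'a::real_normed_field"
  shows "smooth_periodic f \<Longrightarrow> smooth_periodic g \<Longrightarrow> \<forall>u. g u \<noteq> 0 \<Longrightarrow> smooth_periodic (\<lambda>u. f u / g u)"
  by (simp add: smooth_periodic_def smooth_fun_divide)

lemma smooth_periodic_norm:
  fixes z :: "real \<Rightarrow> complex"
  shows "smooth_periodic z \<Longrightarrow> \<forall>u. z u \<noteq> 0 \<Longrightarrow> smooth_periodic (\<lambda>u. norm (z u))"
  by (simp add: smooth_periodic_def smooth_fun_norm)

lemma smooth_periodic_angular:
  fixes z :: "real \<Rightarrow> complex" and q :: "real \<Rightarrow> real"
  shows "smooth_periodic z \<Longrightarrow> \<forall>u. z u \<noteq> 0 \<Longrightarrow> smooth_periodic q \<Longrightarrow> smooth_periodic (\<lambda>u. angular q (z u))"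
  by (simp add: smooth_periodic_def smooth_fun_angular)

lemma integral_vderiv_periodic:
  fixes f :: "real \<Rightarrow> 'a::euclidean_space"
  shows "smooth_periodic f \<Longrightarrow> integral {0..2 * pi} (vderiv f) = 0"
  by (rule integral_periodic_derivative[of f])
    (auto simp: smooth_periodic_def intro: smooth_fun_SucD)

lemma regular_closed_curve_velocity:
  assumes "regular_closed_curve \<gamma>"
  shows "smooth_periodic \<gamma>" "smooth_periodic (vderiv \<gamma>)" "\<forall>u. vderiv \<gamma> u \<noteq> 0"
  using assms smooth_periodic_vderiv[of \<gamma>] by (auto simp: regular_closed_curve_def smooth_periodic_def)

text \<open>
  Here \<open>h\<close> is the reciprocal radial function of the indicatrix. The indicatrix has positive curvature
  exactly if \<open>h + h'' > 0\<close>.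
\<close>

locale minkowski_plane =
  fixes h :: "real \<Rightarrow> real"
  assumes smooth_h: "smooth_fun h"
    and h_pi: "h (x + pi) = h x"
    and h_pos: "h x > 0"
    and convex: "h x + vderiv (vderiv h) x > 0"
begin

abbreviation curvature_radius :: "real \<Rightarrow> real" where
  "curvature_radius \<equiv> \<lambda>x. h x + vderiv (vderiv h) x"

lemma smooth_periodic_h: "smooth_periodic h"
  using smooth_h h_pi[of "x + pi" for x] h_pi by (simp add: smooth_periodic_def add.assoc)

lemma smooth_periodic_curvature_radius: "smooth_periodic curvature_radius"
  using smooth_periodic_h smooth_periodic_vderiv[OF smooth_periodic_vderiv[OF smooth_periodic_h]]
  by (simp add: smooth_periodic_def smooth_fun_add)

lemma mink_norm_pos: "z \<noteq> 0 \<Longrightarrow> mink_norm h z > 0"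
  by (simp add: mink_norm_def angular_def h_pos)

end

locale minkowski_curve = minkowski_plane +
  fixes \<gamma> :: "real \<Rightarrow> complex"
  assumes regular: "regular_closed_curve \<gamma>"
begin

abbreviation z where "z \<equiv> vderiv \<gamma>"

lemmas velocity = regular_closed_curve_velocity[OF regular]

lemma angle: "q (tangent_angle \<gamma> u) = angular q (z u)" if "smooth_periodic q"
  using that velocity by (intro periodic_tangent_angle) (auto simp: smooth_periodic_def)

definition weight :: "real \<Rightarrow> real" where
  "weight u = mink_norm h (z u)"

lemma weight_pos: "weight u > 0"
  using velocity by (simp add: weight_def mink_norm_pos)

lemma smooth_periodic_weight: "smooth_periodic weight"
  unfolding weight_def[abs_def] mink_norm_def
  by (intro smooth_periodic_mult smooth_periodic_norm smooth_periodic_angular velocity smooth_periodic_h)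

lemma mink_deriv_eq: "mink_deriv h \<gamma> f u = vderiv f u / weight u"
  by (simp add: mink_deriv_def arc_deriv_def curve_speed_def angle[OF smooth_periodic_h]
      weight_def mink_norm_def field_simps)

lemma mink_integral_eq: "mink_integral h \<gamma> f = integral {0..2 * pi} (\<lambda>u. f u * weight u)"
  by (simp add: mink_integral_def curve_speed_def angle[OF smooth_periodic_h] weight_def
      mink_norm_def mult_ac)

lemma mink_length_eq: "mink_length h \<gamma> = integral {0..2 * pi} weight"
  by (simp add: mink_length_def mink_integral_eq)

lemma mink_curvature_eq:
  "mink_curvature h \<gamma> u = Im (vderiv z u / z u) / norm (z u) * angular curvature_radius (z u)"
  using velocity
  by (simp add: mink_curvature_def angle[OF smooth_periodic_curvature_radius] 
      euclidean_curvature_eq smooth_periodic_def)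

lemma mink_normal_eq:
  "mink_normal h \<gamma> u = \<i> * (of_real (angular h (z u)) + \<i> * of_real (angular (vderiv h) (z u))) * sgn (z u)"
  by (simp add: mink_normal_def unit_normal_def unit_tangent_eq_sgn scaleR_conv_of_real
      angle[OF smooth_periodic_h] angle[OF smooth_periodic_vderiv[OF smooth_periodic_h]] algebra_simps)

lemma smooth_periodic_mink_curvature: "smooth_periodic (mink_curvature h \<gamma>)"
proof -
  have "smooth_periodic (\<lambda>u. vderiv z u / z u)"
    by (intro smooth_periodic_divide smooth_periodic_vderiv velocity)
  then have "smooth_periodic (\<lambda>u. Im (vderiv z u / z u))"
    unfolding smooth_periodic_def using smooth_fun_linear[OF bounded_linear_Im] by auto
  then have "smooth_periodic (\<lambda>u. Im (vderiv z u / z u) / norm (z u) * angular curvature_radius (z u))"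
    using velocity(3)
    by (intro smooth_periodic_mult smooth_periodic_divide smooth_periodic_norm smooth_periodic_angular
        velocity smooth_periodic_curvature_radius) auto
  then show ?thesis by (simp add: mink_curvature_eq[abs_def])
qed

lemma smooth_periodic_mink_deriv: "smooth_periodic f \<Longrightarrow> smooth_periodic (mink_deriv h \<gamma> f)"
  using weight_pos unfolding mink_deriv_eq[abs_def]
  by (intro smooth_periodic_divide smooth_periodic_vderiv smooth_periodic_weight)
    (auto simp: less_imp_neq[symmetric])

lemma smooth_periodic_mink_deriv_iterate: "smooth_periodic f \<Longrightarrow> smooth_periodic ((mink_deriv h \<gamma> ^^ m) f)"
  by (induction m) (auto intro: smooth_periodic_mink_deriv)

lemma smooth_periodic_mink_curvature_deriv: "smooth_periodic (mink_curvature_deriv h \<gamma> m)"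
  unfolding mink_curvature_deriv_def
  by (intro smooth_periodic_mink_deriv_iterate smooth_periodic_mink_curvature)

lemma mink_integral_by_parts:
  assumes f: "smooth_periodic f" and g: "smooth_periodic g"
  shows "mink_integral h \<gamma> (\<lambda>u. f u * mink_deriv h \<gamma> g u) = - mink_integral h \<gamma> (\<lambda>u. mink_deriv h \<gamma> f u * g u)"
proof -
  have w: "weight u \<noteq> 0" for u using weight_pos[of u] by simp
  have i: "(\<lambda>u. f u * vderiv g u) integrable_on {0..2 * pi}" "(\<lambda>u. vderiv f u * g u) integrable_on {0..2 * pi}"
    by (intro integrable_continuous_interval smooth_periodic_continuous smooth_periodic_mult
        smooth_periodic_vderiv f g)+
  have "vderiv (\<lambda>u. f u * g u) = (\<lambda>u. f u * vderiv g u + vderiv f u * g u)"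
    by (intro ext vderiv_eqI has_vector_derivative_mult smooth_periodic_has_vector_derivative f g)
  then have "integral {0..2 * pi} (\<lambda>u. f u * vderiv g u + vderiv f u * g u) = 0"
    using integral_vderiv_periodic[OF smooth_periodic_mult[OF f g]] by simp
  then have "integral {0..2 * pi} (\<lambda>u. f u * vderiv g u) + integral {0..2 * pi} (\<lambda>u. vderiv f u * g u) = 0"
    using i by (simp add: integral_add)
  then show ?thesis
    using w by (simp add: mink_integral_eq mink_deriv_eq)
qed

lemma mink_integral_iterated_parts:
  "smooth_periodic f \<Longrightarrow> smooth_periodic g \<Longrightarrow>
    mink_integral h \<gamma> (\<lambda>u. f u * (mink_deriv h \<gamma> ^^ m) g u)
      = (-1) ^ m * mink_integral h \<gamma> (\<lambda>u. (mink_deriv h \<gamma> ^^ m) f u * g u)"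
proof (induction m arbitrary: f)
  case (Suc m)
  have "mink_integral h \<gamma> (\<lambda>u. f u * (mink_deriv h \<gamma> ^^ Suc m) g u)
      = - mink_integral h \<gamma> (\<lambda>u. mink_deriv h \<gamma> f u * (mink_deriv h \<gamma> ^^ m) g u)"
    using mink_integral_by_parts[OF Suc.prems(1) smooth_periodic_mink_deriv_iterate[OF Suc.prems(2)]]
    by simp
  then show ?case
    using Suc.IH[OF smooth_periodic_mink_deriv Suc.prems(2)] Suc.prems(1)
    by (simp add: funpow_Suc_right del: funpow.simps(2))
qed simp

lemma mink_integral_curvature_parts:
  "mink_integral h \<gamma> (\<lambda>u. mink_curvature h \<gamma> u * mink_curvature_deriv h \<gamma> (2 * p) u)
    = (-1) ^ p * mink_integral h \<gamma> (\<lambda>u. (mink_curvature_deriv h \<gamma> p u)\<^sup>2)"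
proof -
  have "mink_curvature_deriv h \<gamma> (2 * p) = (mink_deriv h \<gamma> ^^ p) (mink_curvature_deriv h \<gamma> p)"
    by (simp add: mink_curvature_deriv_def mult_2 funpow_add)
  then show ?thesis
    using mink_integral_iterated_parts[OF smooth_periodic_mink_curvature
        smooth_periodic_mink_curvature_deriv[of p], of p]
    by (simp add: power2_eq_square mink_curvature_deriv_def)
qed

end

section \<open>Wirtinger inequalities with respect to a length element\<close>

text \<open>
  The function \<open>t = \<alpha> tan (\<alpha> s)\<close>, with \<open>s\<close> the length measured from the midpoint, solves the Riccati
  equation \<open>t\<^sub>s = \<alpha>\<^sup>2 + t\<^sup>2\<close>. Hence \<open>(f\<^sub>s + t f)\<^sup>2 = f\<^sub>s\<^sup>2 - \<alpha>\<^sup>2 f\<^sup>2 + (t f\<^sup>2)\<^sub>s\<close>, and the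
  last term integrates to zero. For \<open>\<alpha> < \<pi> / \<l>\<close> \<open>t\<close> has no pole on the interval.
\<close>

lemma wirtinger_dirichlet:
  fixes f g w S :: "real \<Rightarrow> real"
  assumes ab: "a \<le> b"
    and df: "\<And>x. (f has_real_derivative w x * g x) (at x)"
    and dS: "\<And>x. (S has_real_derivative w x) (at x)"
    and cont: "continuous_on {a..b} g" "continuous_on {a..b} w"
    and w: "\<And>x. w x \<ge> 0"
    and ends: "f a = 0" "f b = 0"
    and len: "S b = S a + \<l>" "\<l> > 0"
  shows "pi\<^sup>2 * integral {a..b} (\<lambda>x. (f x)\<^sup>2 * w x) \<le> \<l>\<^sup>2 * integral {a..b} (\<lambda>x. (g x)\<^sup>2 * w x)"
proof -
  let ?F = "integral {a..b} (\<lambda>x. (f x)\<^sup>2 * w x)" and ?G = "integral {a..b} (\<lambda>x. (g x)\<^sup>2 * w x)"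
  have contf: "continuous_on {a..b} f" and contS: "continuous_on {a..b} S"
    using df dS by (meson DERIV_isCont continuous_at_imp_continuous_on)+
  have mono: "S x \<le> S y" if "x \<le> y" for x y
    using DERIV_nonneg_imp_nondecreasing[OF that, of S] dS w by blast
  have main: "\<alpha>\<^sup>2 * ?F \<le> ?G" if \<alpha>: "0 < \<alpha>" "\<alpha> * \<l> < pi" for \<alpha>
  proof -
    define s where "s x = \<alpha> * (S x - (S a + \<l> / 2))" for x
    have ds: "(s has_real_derivative \<alpha> * w x) (at x)" for x
      unfolding s_def by (auto intro!: derivative_eq_intros dS)
    have cos: "cos (s x) > 0" if "x \<in> {a..b}" for x
    proof -
      have "\<bar>S x - (S a + \<l> / 2)\<bar> \<le> \<l> / 2"
        using mono[of a x] mono[of x b] that len by (simp add: abs_le_iff field_simps)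
      then have "\<bar>s x\<bar> \<le> \<alpha> * (\<l> / 2)"
        using \<alpha> by (simp add: s_def abs_mult)
      then show ?thesis using \<alpha> by (intro cos_gt_zero_pi) auto
    qed
    let ?d = "\<lambda>x. w x * (2 * \<alpha> * f x * g x * tan (s x) + \<alpha>\<^sup>2 * (f x)\<^sup>2 * (1 + (tan (s x))\<^sup>2))"
    have "((\<lambda>x. \<alpha> * (f x)\<^sup>2 * tan (s x)) has_real_derivative ?d x) (at x)" if "x \<in> {a..b}" for x
    proof -
      have c: "cos (s x) \<noteq> 0" using cos[OF that] by simp
      have "((\<lambda>x. tan (s x)) has_real_derivative (1 + (tan (s x))\<^sup>2) * (\<alpha> * w x)) (at x)"
        using DERIV_chain2[OF DERIV_tan[OF c] ds[of x]] tan_sec[OF c] by (simp add: inverse_eq_divide power_divide)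
      moreover have "((\<lambda>x. \<alpha> * (f x)\<^sup>2) has_real_derivative 2 * \<alpha> * f x * (w x * g x)) (at x)"
        by (auto intro!: derivative_eq_intros df)
      ultimately have "((\<lambda>x. \<alpha> * (f x)\<^sup>2 * tan (s x)) has_real_derivative
          2 * \<alpha> * f x * (w x * g x) * tan (s x) + (1 + (tan (s x))\<^sup>2) * (\<alpha> * w x) * (\<alpha> * (f x)\<^sup>2)) (at x)"
        by (rule DERIV_mult[rotated])
      then show ?thesis by (simp add: algebra_simps power2_eq_square)
    qed
    then have "(?d has_integral (\<alpha> * (f b)\<^sup>2 * tan (s b) - \<alpha> * (f a)\<^sup>2 * tan (s a))) {a..b}"
      using ab by (intro fundamental_theorem_of_calculus)
        (auto simp: has_real_derivative_iff_has_vector_derivative intro: has_vector_derivative_at_within)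
    then have d: "(?d has_integral 0) {a..b}" by (simp add: ends)
    have F: "((\<lambda>x. (f x)\<^sup>2 * w x) has_integral ?F) {a..b}"
      and G: "((\<lambda>x. (g x)\<^sup>2 * w x) has_integral ?G) {a..b}"
      by (intro integrable_integral integrable_continuous_interval continuous_intros cont contf)+
    have "((\<lambda>x. (g x)\<^sup>2 * w x - \<alpha>\<^sup>2 * ((f x)\<^sup>2 * w x) + ?d x) has_integral ?G - \<alpha>\<^sup>2 * ?F + 0) {a..b}"
      by (intro has_integral_add has_integral_diff has_integral_mult_right F G d)
    moreover have "(g x)\<^sup>2 * w x - \<alpha>\<^sup>2 * ((f x)\<^sup>2 * w x) + ?d x = w x * (g x + \<alpha> * f x * tan (s x))\<^sup>2" for x
      by (simp add: algebra_simps power2_eq_square)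
    ultimately have "((\<lambda>x. w x * (g x + \<alpha> * f x * tan (s x))\<^sup>2) has_integral ?G - \<alpha>\<^sup>2 * ?F + 0) {a..b}"
      by (simp only:)
    then have "?G - \<alpha>\<^sup>2 * ?F + 0 \<ge> 0"
      by (rule has_integral_nonneg) (simp add: w)
    then show ?thesis by simp
  qed
  have "(pi / \<l>)\<^sup>2 * ?F \<le> ?G"
  proof (rule field_le_mult_one_interval)
    fix c :: real assume c: "0 < c" "c < 1"
    have "sqrt c < 1" using c by simp
    then have "(sqrt c * (pi / \<l>))\<^sup>2 * ?F \<le> ?G"
      using c len by (intro main) auto
    moreover have "(sqrt c * x)\<^sup>2 = c * x\<^sup>2" for x using c by (simp add: power_mult_distrib)
    ultimately show "c * ((pi / \<l>)\<^sup>2 * ?F) \<le> ?G" by (simp only: mult.assoc)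
  qed
  then show ?thesis using len by (simp add: power_divide field_simps)
qed

context minkowski_curve
begin

lemma has_real_derivative_mink_deriv:
  "smooth_periodic f \<Longrightarrow> (f has_real_derivative weight u * mink_deriv h \<gamma> f u) (at u)"
  using weight_pos[of u] smooth_periodic_has_vector_derivative[of f u]
  by (simp add: mink_deriv_eq has_real_derivative_iff_has_vector_derivative)

lemma mink_length_pos: "mink_length h \<gamma> > 0"
proof -
  obtain S where S: "\<And>u. (S has_vector_derivative weight u) (at u)"
    using antiderivative_exists[OF smooth_periodic_continuous[OF smooth_periodic_weight]] by blast
  have "S 0 < S (2 * pi)"
    using DERIV_pos_imp_increasing[of 0 "2 * pi" S] S weight_pos
    by (auto simp: has_real_derivative_iff_has_vector_derivative)
  then show ?thesis using integral_eq_diff[OF S, of 0 "2 * pi"] by (simp add: mink_length_eq)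
qed

lemma arc_length_exists:
  obtains S where "\<And>u. (S has_real_derivative weight u) (at u)"
    and "\<And>u. S (u + 2 * pi) = S u + mink_length h \<gamma>" and "strict_mono S"
proof -
  obtain S where S: "\<And>u. (S has_vector_derivative weight u) (at u)"
    using antiderivative_exists[OF smooth_periodic_continuous[OF smooth_periodic_weight]] by blast
  have "S (u + 2 * pi) = S u + mink_length h \<gamma>" for u
  proof -
    have "integral {u..u + 2 * pi} weight = integral {0..2 * pi} weight"
      using smooth_periodic_weight
      by (intro integral_periodic_shift) (auto simp: smooth_periodic_def intro: smooth_fun_continuous)
    then show ?thesis using integral_eq_diff[OF S, of u "u + 2 * pi"] by (simp add: mink_length_eq)
  qed
  moreover have "strict_mono S"
  proof (rule strict_monoI)
    fix x y :: real assume "x < y"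
    then show "S x < S y"
      using DERIV_pos_imp_increasing[of x y S] S weight_pos
      by (auto simp: has_real_derivative_iff_has_vector_derivative)
  qed
  ultimately show thesis using that S by (auto simp: has_real_derivative_iff_has_vector_derivative)
qed

lemma mink_integral_shift:
  assumes "smooth_periodic f"
  shows "integral {a..a + 2 * pi} (\<lambda>u. f u * weight u) = mink_integral h \<gamma> f"
  unfolding mink_integral_eq
  using smooth_periodic_mult[OF assms smooth_periodic_weight]
  by (intro integral_periodic_shift) (auto simp: smooth_periodic_def intro: smooth_fun_continuous)

text \<open>Cutting the curve at the zero of \<open>f\<close> gives an interval whose length is that of the curve.\<close>

lemma wirtinger_vanishing:
  assumes f: "smooth_periodic f" and a: "f a = 0"
  shows "pi\<^sup>2 * mink_integral h \<gamma> (\<lambda>u. (f u)\<^sup>2)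
    \<le> (mink_length h \<gamma>)\<^sup>2 * mink_integral h \<gamma> (\<lambda>u. (mink_deriv h \<gamma> f u)\<^sup>2)"
proof -
  obtain S where S: "\<And>u. (S has_real_derivative weight u) (at u)"
    "\<And>u. S (u + 2 * pi) = S u + mink_length h \<gamma>" using arc_length_exists by metis
  have per: "f (a + 2 * pi) = 0" using f a by (simp add: smooth_periodic_def)
  have "pi\<^sup>2 * integral {a..a + 2 * pi} (\<lambda>u. (f u)\<^sup>2 * weight u)
      \<le> (mink_length h \<gamma>)\<^sup>2 * integral {a..a + 2 * pi} (\<lambda>u. (mink_deriv h \<gamma> f u)\<^sup>2 * weight u)"
    by (rule wirtinger_dirichlet[OF _ has_real_derivative_mink_deriv[OF f] S(1)])
      (use S(2) a per mink_length_pos weight_pos f in \<open>auto simp: less_imp_le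
        intro: smooth_periodic_continuous smooth_periodic_mink_deriv smooth_periodic_weight\<close>)
  then show ?thesis
    by (simp add: mink_integral_shift smooth_periodic_power2 smooth_periodic_mink_deriv f)
qed

text \<open>
  A periodic function takes the same value at some two points that halve the length. Subtracting this
  value, the Dirichlet inequality applies to both halves; since \<open>f\<close> has mean zero, the subtraction
  only increases the integral of the square.
\<close>

lemma wirtinger_mean_zero:
  assumes f: "smooth_periodic f" and mean: "mink_integral h \<gamma> f = 0"
  shows "(2 * pi)\<^sup>2 * mink_integral h \<gamma> (\<lambda>u. (f u)\<^sup>2)
    \<le> (mink_length h \<gamma>)\<^sup>2 * mink_integral h \<gamma> (\<lambda>u. (mink_deriv h \<gamma> f u)\<^sup>2)"
proof -
  let ?L = "mink_length h \<gamma>"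
  obtain S where S: "\<And>u. (S has_real_derivative weight u) (at u)"
    "\<And>u. S (u + 2 * pi) = S u + ?L" and Smono: "strict_mono S" using arc_length_exists by metis
  have contS: "continuous_on A S" for A
    using S(1) by (meson DERIV_isCont continuous_at_imp_continuous_on)
  have contf: "continuous_on A f" for A using f by (rule smooth_periodic_continuous)
  have Lpos: "?L > 0" by (rule mink_length_pos)
  \<comment> \<open>The point of the parameter interval with a given arc length; it depends continuously on it.\<close>
  define R where "R = the_inv S"
  have inj: "inj S" using Smono by (rule strict_mono_imp_inj_on)
  have RS: "R (S x) = x" for x by (simp add: R_def the_inv_f_f inj)
  have image: "S ` {0..2 * pi} = {S 0..S 0 + ?L}"
  proof -
    have "{S 0..S 0 + ?L} \<subseteq> S ` {0..2 * pi}"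
      using IVT'[of S 0 _ "2 * pi", OF _ _ _ contS] S(2)[of 0] by fastforce
    moreover have "S ` {0..2 * pi} \<subseteq> {S 0..S 0 + ?L}"
      unfolding S(2)[of 0, symmetric] using Smono by (auto simp: strict_mono_less_eq)
    ultimately show ?thesis by blast
  qed
  have contR: "continuous_on {S 0..S 0 + ?L} R"
    unfolding image[symmetric] by (rule continuous_on_inv[OF contS]) (auto simp: RS)
  have SR: "S (R y) = y" "R y \<in> {0..2 * pi}" if "y \<in> {S 0..S 0 + ?L}" for y
    using that RS unfolding image[symmetric] by auto
  define \<psi> where "\<psi> x = f (R (S x + ?L / 2)) - f x" for x
  define m where "m = R (S 0 + ?L / 2)"
  have m: "S m = S 0 + ?L / 2" "m \<in> {0..2 * pi}"
    using SR[of "S 0 + ?L / 2"] Lpos by (auto simp: m_def)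
  have "S m + ?L / 2 = S (2 * pi)" using S(2)[of 0] m by simp
  then have "R (S m + ?L / 2) = 2 * pi" by (simp only: RS)
  moreover have "f (0 + 2 * pi) = f 0" using f by (simp only: smooth_periodic_def)
  ultimately have anti: "\<psi> m = - \<psi> 0" by (simp add: \<psi>_def flip: m_def)
  \<comment> \<open>\<open>\<psi>\<close> compares \<open>f\<close> with its value half a length further on. A zero exists as \<open>\<psi> m = - \<psi> 0\<close>.\<close>
  have "continuous_on {0..m} \<psi>"
    unfolding \<psi>_def
  proof (intro continuous_on_diff contf continuous_on_compose2[OF contf[of UNIV]]
      continuous_on_compose2[OF contR] continuous_on_add contS continuous_on_const)
    show "(\<lambda>x. S x + ?L / 2) ` {0..m} \<subseteq> {S 0..S 0 + ?L}"
    proof clarsimp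
      fix x assume "0 \<le> x" "x \<le> m"
      then have "S 0 \<le> S x" "S x \<le> S m" using Smono by (simp_all add: strict_mono_less_eq)
      then show "S 0 \<le> S x + ?L / 2 \<and> S x + ?L / 2 \<le> S 0 + ?L" using m Lpos by simp
    qed
  qed simp
  then have "\<exists>a. 0 \<le> a \<and> a \<le> m \<and> \<psi> a = 0"
    using IVT'[of \<psi> 0 0 m] IVT2'[of \<psi> m 0 0] anti m by (cases "\<psi> 0 \<le> 0") auto
  then obtain a where a: "0 \<le> a" "a \<le> m" "\<psi> a = 0" by blast
  define b where "b = R (S a + ?L / 2)"
  have "S 0 \<le> S a" "S a \<le> S m" using a Smono by (simp_all add: strict_mono_less_eq)
  then have Sb: "S b = S a + ?L / 2"
    unfolding b_def using m Lpos by (intro SR) auto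
  have fb: "f b = f a" using a by (simp add: \<psi>_def b_def)
  have "S a < S b" "S b < S (a + 2 * pi)" using Sb Lpos S(2) by simp_all
  then have ab: "a \<le> b" "b \<le> a + 2 * pi" using Smono by (simp_all add: strict_mono_less)
  define c where "c = f a"
  let ?g = "mink_deriv h \<gamma> f"
  let ?F = "\<lambda>u. (f u - c)\<^sup>2 * weight u" and ?G = "\<lambda>u. (?g u)\<^sup>2 * weight u"
  have df: "((\<lambda>u. f u - c) has_real_derivative weight u * ?g u) (at u)" for u
    using has_real_derivative_mink_deriv[OF f, of u] by (auto intro!: derivative_eq_intros)
  have contg: "continuous_on A ?g" and contw: "continuous_on A weight" for A
    by (intro smooth_periodic_continuous smooth_periodic_mink_deriv smooth_periodic_weight f)+
  have half: "pi\<^sup>2 * integral {x..y} ?F \<le> (?L / 2)\<^sup>2 * integral {x..y} ?G"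
    if "x \<le> y" "f x = c" "f y = c" "S y = S x + ?L / 2" for x y
    by (rule wirtinger_dirichlet[OF that(1) df S(1) contg contw])
      (use that Lpos weight_pos in \<open>auto simp: less_imp_le\<close>)
  have split: "integral {a..a + 2 * pi} k = integral {a..b} k + integral {b..a + 2 * pi} k"
    if "continuous_on UNIV k" for k :: "real \<Rightarrow> real"
    using ab that by (intro Henstock_Kurzweil_Integration.integral_combine[symmetric]
        integrable_continuous_interval) (auto intro: continuous_on_subset)
  have per: "f (a + 2 * pi) = c" using f by (simp add: smooth_periodic_def c_def)
  have "pi\<^sup>2 * integral {a..a + 2 * pi} ?F \<le> (?L / 2)\<^sup>2 * integral {a..a + 2 * pi} ?G"
  proof -
    have "pi\<^sup>2 * integral {a..b} ?F \<le> (?L / 2)\<^sup>2 * integral {a..b} ?G"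
      using fb Sb ab by (intro half) (auto simp: c_def)
    moreover have "pi\<^sup>2 * integral {b..a + 2 * pi} ?F \<le> (?L / 2)\<^sup>2 * integral {b..a + 2 * pi} ?G"
      using fb Sb ab per S(2)[of a] by (intro half) (auto simp: c_def)
    moreover have "continuous_on UNIV ?F" "continuous_on UNIV ?G"
      by (intro continuous_intros contf contg contw)+
    ultimately show ?thesis by (simp add: split distrib_left)
  qed
  moreover have "integral {a..a + 2 * pi} ?F = mink_integral h \<gamma> (\<lambda>u. (f u)\<^sup>2) + c\<^sup>2 * ?L"
  proof -
    have int: "((\<lambda>u. f u * weight u) has_integral 0) {0..2 * pi}"
      "((\<lambda>u. (f u)\<^sup>2 * weight u) has_integral mink_integral h \<gamma> (\<lambda>u. (f u)\<^sup>2)) {0..2 * pi}"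
      "(weight has_integral ?L) {0..2 * pi}"
      using mean unfolding mink_integral_eq mink_length_eq
      by (auto intro!: integrable_integral integrable_continuous_interval continuous_intros contf contw
          simp: has_integral_iff)
    have "((\<lambda>u. (f u)\<^sup>2 * weight u - 2 * c * (f u * weight u) + c\<^sup>2 * weight u)
        has_integral mink_integral h \<gamma> (\<lambda>u. (f u)\<^sup>2) - 2 * c * 0 + c\<^sup>2 * ?L) {0..2 * pi}"
      by (intro has_integral_add has_integral_diff has_integral_mult_right int)
    then have "integral {0..2 * pi} ?F = mink_integral h \<gamma> (\<lambda>u. (f u)\<^sup>2) + c\<^sup>2 * ?L"
      by (simp add: has_integral_iff algebra_simps power2_eq_square)
    moreover have "integral {a..a + 2 * pi} ?F = integral {0..2 * pi} ?F"
      using f smooth_periodic_weight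
      by (intro integral_periodic_shift continuous_intros contf contw) (auto simp: smooth_periodic_def)
    ultimately show ?thesis by simp
  qed
  moreover have "integral {a..a + 2 * pi} ?G = mink_integral h \<gamma> (\<lambda>u. (?g u)\<^sup>2)"
    by (intro mink_integral_shift smooth_periodic_power2 smooth_periodic_mink_deriv f)
  ultimately have "pi\<^sup>2 * (mink_integral h \<gamma> (\<lambda>u. (f u)\<^sup>2) + c\<^sup>2 * ?L)
      \<le> (?L / 2)\<^sup>2 * mink_integral h \<gamma> (\<lambda>u. (?g u)\<^sup>2)"
    by (simp only:)
  moreover have "pi\<^sup>2 * mink_integral h \<gamma> (\<lambda>u. (f u)\<^sup>2) \<le> pi\<^sup>2 * (mink_integral h \<gamma> (\<lambda>u. (f u)\<^sup>2) + c\<^sup>2 * ?L)"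
    using Lpos by (intro mult_left_mono) auto
  ultimately have "pi\<^sup>2 * mink_integral h \<gamma> (\<lambda>u. (f u)\<^sup>2) \<le> (?L / 2)\<^sup>2 * mink_integral h \<gamma> (\<lambda>u. (?g u)\<^sup>2)"
    by (rule order.trans[rotated])
  then show ?thesis by (simp add: power_divide power_mult_distrib)
qed

lemma mink_integral_mink_deriv:
  assumes "smooth_periodic f"
  shows "mink_integral h \<gamma> (mink_deriv h \<gamma> f) = 0"
proof -
  have "mink_deriv h \<gamma> f u * weight u = vderiv f u" for u
    using weight_pos[of u] by (simp add: mink_deriv_eq)
  then show ?thesis using integral_vderiv_periodic[OF assms] by (simp add: mink_integral_eq)
qed

lemma wirtinger_curvature_deriv:
  "(2 * pi)\<^sup>2 * mink_integral h \<gamma> (\<lambda>u. (mink_curvature_deriv h \<gamma> (Suc m) u)\<^sup>2)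
    \<le> (mink_length h \<gamma>)\<^sup>2 * mink_integral h \<gamma> (\<lambda>u. (mink_curvature_deriv h \<gamma> (Suc (Suc m)) u)\<^sup>2)"
proof -
  have suc: "mink_curvature_deriv h \<gamma> (Suc n) = mink_deriv h \<gamma> (mink_curvature_deriv h \<gamma> n)" for n
    by (simp add: mink_curvature_deriv_def)
  show ?thesis
    unfolding suc[of "Suc m"]
    by (intro wirtinger_mean_zero smooth_periodic_mink_curvature_deriv)
      (simp add: suc mink_integral_mink_deriv smooth_periodic_mink_curvature_deriv)
qed

text \<open>
  The Cauchy-Schwarz inequality bounds \<open>\<integral> \<kappa>\<^sup>2 d\<sigma>\<close> from below by the total curvature. A zero of the
  curvature allows the first Wirtinger step; the further steps use that derivatives have mean zero.
\<close>

lemma curvature_energy_lower_bound: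
  assumes zero: "mink_curvature h \<gamma> u0 = 0" and "p \<ge> 1"
  shows "4 ^ (p - 1) * pi ^ (2 * p) * (mink_integral h \<gamma> (mink_curvature h \<gamma>))\<^sup>2
    \<le> (mink_length h \<gamma>) ^ (2 * p + 1) * mink_integral h \<gamma> (\<lambda>u. (mink_curvature_deriv h \<gamma> p u)\<^sup>2)"
proof -
  let ?L = "mink_length h \<gamma>"
  define E where "E m = mink_integral h \<gamma> (\<lambda>u. (mink_curvature_deriv h \<gamma> m u)\<^sup>2)" for m
  define K where "K = mink_integral h \<gamma> (mink_curvature h \<gamma>)"
  have L: "?L > 0" by (rule mink_length_pos)
  have E0: "K\<^sup>2 \<le> ?L * E 0"
  proof -
    let ?k = "mink_curvature h \<gamma>"
    have sp: "smooth_periodic (\<lambda>u. ?k u * weight u)" "smooth_periodic (\<lambda>u. (?k u)\<^sup>2 * weight u)"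
      by (intro smooth_periodic_mult smooth_periodic_power2 smooth_periodic_mink_curvature
          smooth_periodic_weight)+
    have int: "(f has_integral integral {0..2 * pi} f) {0..2 * pi}" if "smooth_periodic f" for f :: "real \<Rightarrow> real"
      by (rule integrable_integral[OF integrable_continuous_interval[OF smooth_periodic_continuous[OF that]]])
    have "((\<lambda>u. ?k u * weight u) has_integral K) {0..2 * pi}"
      "((\<lambda>u. (?k u)\<^sup>2 * weight u) has_integral E 0) {0..2 * pi}"
      "(weight has_integral ?L) {0..2 * pi}"
      using int[OF sp(1)] int[OF sp(2)] int[OF smooth_periodic_weight]
      by (simp_all only: mink_integral_eq mink_length_eq K_def E_def mink_curvature_deriv_def funpow_0)
    then have "((\<lambda>u. ?L\<^sup>2 * ((?k u)\<^sup>2 * weight u) - 2 * ?L * K * (?k u * weight u) + K\<^sup>2 * weight u)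
        has_integral ?L\<^sup>2 * E 0 - 2 * ?L * K * K + K\<^sup>2 * ?L) {0..2 * pi}"
      by (intro has_integral_add has_integral_diff has_integral_mult_right)
    moreover have "?L\<^sup>2 * ((?k u)\<^sup>2 * weight u) - 2 * ?L * K * (?k u * weight u) + K\<^sup>2 * weight u
        = weight u * (?L * ?k u - K)\<^sup>2" for u
      by (simp add: algebra_simps power2_eq_square)
    ultimately have "((\<lambda>u. weight u * (?L * ?k u - K)\<^sup>2)
        has_integral ?L\<^sup>2 * E 0 - 2 * ?L * K * K + K\<^sup>2 * ?L) {0..2 * pi}"
      by (simp only:)
    then have "?L\<^sup>2 * E 0 - 2 * ?L * K * K + K\<^sup>2 * ?L \<ge> 0"
      by (rule has_integral_nonneg) (simp add: weight_pos less_imp_le)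
    then have "0 \<le> ?L * (?L * E 0 - K\<^sup>2)" by (simp add: algebra_simps power2_eq_square)
    then show ?thesis using L by (simp add: zero_le_mult_iff)
  qed
  have E1: "pi\<^sup>2 * E 0 \<le> ?L\<^sup>2 * E 1"
    using wirtinger_vanishing[OF smooth_periodic_mink_curvature zero]
    by (simp add: E_def mink_curvature_deriv_def)
  have "4 ^ m * pi ^ (2 * m) * (pi\<^sup>2 * K\<^sup>2) \<le> ?L ^ (2 * m + 3) * E (Suc m)" for m
  proof (induction m)
    case 0
    have "pi\<^sup>2 * K\<^sup>2 \<le> pi\<^sup>2 * (?L * E 0)" using E0 by (intro mult_left_mono) auto
    also have "\<dots> = ?L * (pi\<^sup>2 * E 0)" by simp
    also have "\<dots> \<le> ?L * (?L\<^sup>2 * E 1)" using L E1 by (intro mult_left_mono) auto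
    finally show ?case by (simp add: power2_eq_square power3_eq_cube mult.assoc) 
  next
    case (Suc m)
    have "4 ^ Suc m * pi ^ (2 * Suc m) * (pi\<^sup>2 * K\<^sup>2) = (2 * pi)\<^sup>2 * (4 ^ m * pi ^ (2 * m) * (pi\<^sup>2 * K\<^sup>2))"
      by (simp add: power2_eq_square)
    also have "\<dots> \<le> (2 * pi)\<^sup>2 * (?L ^ (2 * m + 3) * E (Suc m))"
      using Suc by (intro mult_left_mono) auto
    also have "\<dots> = ?L ^ (2 * m + 3) * ((2 * pi)\<^sup>2 * E (Suc m))" by simp
    also have "\<dots> \<le> ?L ^ (2 * m + 3) * (?L\<^sup>2 * E (Suc (Suc m)))"
      using L wirtinger_curvature_deriv[of m] by (intro mult_left_mono) (auto simp: E_def)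
    also have "\<dots> = ?L ^ (2 * Suc m + 3) * E (Suc (Suc m))" by (simp add: power_add eval_nat_numeral)
    finally show ?case .
  qed
  from this[of "p - 1"] show ?thesis
    using assms(2) by (cases p) (simp_all add: E_def K_def power2_eq_square mult_ac eval_nat_numeral)
qed

end

section \<open>Length and total curvature in the limit\<close>

lemma integral_tendsto_of_bounded:
  fixes f :: "nat \<Rightarrow> real \<Rightarrow> real"
  assumes cont: "\<And>k. continuous_on {a..b} (f k)"
    and bound: "eventually (\<lambda>k. \<forall>x\<in>{a..b}. \<bar>f k x\<bar> \<le> B) sequentially"
    and lim: "\<And>x. x \<in> {a..b} \<Longrightarrow> (\<lambda>k. f k x) \<longlonglongrightarrow> g x"
  shows "(\<lambda>k. integral {a..b} (f k)) \<longlonglongrightarrow> integral {a..b} g"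
proof -
  obtain N where N: "\<And>k x. k \<ge> N \<Longrightarrow> x \<in> {a..b} \<Longrightarrow> \<bar>f k x\<bar> \<le> B"
    using bound unfolding eventually_sequentially by blast
  have "(\<lambda>k. integral {a..b} (f (k + N))) \<longlonglongrightarrow> integral {a..b} g"
    by (rule dominated_convergence[where h = "\<lambda>_. B"])
      (use cont N lim in \<open>auto intro: integrable_continuous_interval LIMSEQ_ignore_initial_segment\<close>)
  then show ?thesis by (rule LIMSEQ_offset)
qed

lemma angular_mult_of_real: "c > 0 \<Longrightarrow> angular q (of_real c * z) = angular q z"
  by (simp add: angular_def Arg_times_of_real)

lemma angular_bounded:
  fixes q :: "real \<Rightarrow> real"
  assumes "smooth_periodic q"
  obtains B where "\<And>z. \<bar>angular q z\<bar> \<le> B" and "B > 0"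
proof -
  have "compact (q ` {-pi..pi})"
    by (intro compact_continuous_image smooth_periodic_continuous assms) simp
  then obtain B where "B > 0" "\<forall>y\<in>q ` {-pi..pi}. norm y \<le> B"
    using compact_imp_bounded bounded_pos by metis
  moreover have "Arg z \<in> {-pi..pi}" for z using Arg_bounded[of z] by auto
  ultimately show thesis using that[of B] by (auto simp: angular_def)
qed

lemma tendsto_angular:
  assumes "smooth_periodic q" and "(f \<longlongrightarrow> z0) F" and "z0 \<noteq> 0"
  shows "((\<lambda>x. angular q (f x)) \<longlongrightarrow> angular q z0) F"
proof -
  have "isCont (angular q) z0"
    using assms by (intro has_derivative_continuous[OF has_derivative_angular[of q "vderiv q"]])
      (auto simp: smooth_periodic_def intro: smooth_fun_SucD)
  then show ?thesis using assms(2) isCont_tendsto_compose by blast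
qed

lemma continuous_on_angular_smooth:
  assumes "smooth_periodic q" and "continuous_on S f" and "\<And>x. x \<in> S \<Longrightarrow> f x \<noteq> 0"
  shows "continuous_on S (\<lambda>x. angular q (f x))"
  using assms by (intro continuous_on_angular[of q "vderiv q"])
    (auto simp: smooth_periodic_def intro: smooth_fun_SucD)

context minkowski_plane
begin

definition density :: "real \<Rightarrow> real" where
  "density x = curvature_radius x * h x"

lemma smooth_periodic_density: "smooth_periodic density"
  unfolding density_def[abs_def]
  by (intro smooth_periodic_mult smooth_periodic_curvature_radius smooth_periodic_h)

text \<open>
  Length and total curvature \<open>\<integral>\<kappa> d\<sigma>\<close> as functions of the velocity and, for the curvature, the
  acceleration. Only these two derivatives have to converge for a passage to the limit.
\<close>

definition velocity_length :: "(real \<Rightarrow> complex) \<Rightarrow> real" where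
  "velocity_length z = integral {0..2 * pi} (\<lambda>u. mink_norm h (z u))"

definition total_curvature :: "(real \<Rightarrow> complex) \<Rightarrow> (real \<Rightarrow> complex) \<Rightarrow> real" where
  "total_curvature z z\<^sub>1 = integral {0..2 * pi} (\<lambda>u. Im (z\<^sub>1 u / z u) * angular density (z u))"

lemma regular_length_eq:
  assumes "regular_closed_curve \<gamma>"
  shows "mink_length h \<gamma> = velocity_length (vderiv \<gamma>)"
proof -
  interpret minkowski_curve h \<gamma> by unfold_locales (rule assms)
  show ?thesis by (simp add: mink_length_eq velocity_length_def weight_def[abs_def])
qed

lemma regular_total_curvature_eq:
  assumes "regular_closed_curve \<gamma>"
  shows "mink_integral h \<gamma> (mink_curvature h \<gamma>) = total_curvature (vderiv \<gamma>) (vderiv (vderiv \<gamma>))"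
proof -
  interpret minkowski_curve h \<gamma> by unfold_locales (rule assms)
  show ?thesis using velocity(3)
    by (simp add: mink_integral_eq mink_curvature_eq total_curvature_def weight_def mink_norm_def
        density_def[abs_def] angular_def mult.assoc)
qed

text \<open>
  A change of parameter multiplies the velocity by \<open>\<phi>'\<close>, which keeps its direction, and adds the real
  number \<open>\<phi>'' / \<phi>'\<close> to \<open>z' / z\<close>, which is invisible in the imaginary part.
\<close>

lemma
  fixes \<phi> z z' :: "real \<Rightarrow> _"
  assumes \<phi>: "circle_reparametrization \<phi>"
    and z: "continuous_on UNIV z" "continuous_on UNIV z'" "\<And>u. z (u + 2 * pi) = z u"
      "\<And>u. z' (u + 2 * pi) = z' u" "\<And>u. z u \<noteq> 0"
  defines "\<phi>' \<equiv> vderiv \<phi>"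
  shows velocity_length_reparametrization:
      "velocity_length (\<lambda>v. of_real (\<phi>' v) * z (\<phi> v)) = velocity_length z"
    and total_curvature_reparametrization:
      "total_curvature (\<lambda>v. of_real (\<phi>' v) * z (\<phi> v))
        (\<lambda>v. of_real (\<phi>' v) * (of_real (\<phi>' v) * z' (\<phi> v)) + of_real (\<phi>'' v) * z (\<phi> v)) = total_curvature z z'"
proof -
  have pos: "\<phi>' v > 0" for v using \<phi> by (simp add: circle_reparametrization_def \<phi>'_def)
  have d: "(\<phi> has_vector_derivative \<phi>' v) (at v)" for v
    using \<phi> by (simp add: circle_reparametrization_def \<phi>'_def smooth_fun_SucD)
  have wrap: "\<phi> (0 + 2 * pi) = \<phi> 0 + 2 * pi"
    using \<phi> unfolding circle_reparametrization_def by blast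
  have "integral {0..0 + 2 * pi} (\<lambda>v. \<phi>' v * mink_norm h (z (\<phi> v))) = velocity_length z"
    unfolding velocity_length_def
    using z by (intro integral_periodic_substitution[OF _ _ _ d wrap])
      (auto simp: mink_norm_def intro!: continuous_intros continuous_on_angular_smooth smooth_periodic_h)
  then show "velocity_length (\<lambda>v. of_real (\<phi>' v) * z (\<phi> v)) = velocity_length z"
    using pos by (simp add: velocity_length_def mink_norm_def angular_mult_of_real norm_mult
        less_imp_le mult.assoc)
  have eq: "Im ((of_real (\<phi>' v) * (of_real (\<phi>' v) * z' (\<phi> v)) + of_real (\<phi>'' v) * z (\<phi> v))
      / (of_real (\<phi>' v) * z (\<phi> v))) = \<phi>' v * Im (z' (\<phi> v) / z (\<phi> v))" for v
  proof -
    have "(of_real (\<phi>' v) * (of_real (\<phi>' v) * z' (\<phi> v)) + of_real (\<phi>'' v) * z (\<phi> v))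
      / (of_real (\<phi>' v) * z (\<phi> v)) = of_real (\<phi>' v) * (z' (\<phi> v) / z (\<phi> v)) + of_real (\<phi>'' v / \<phi>' v)"
      using pos[of v] z(5)[of "\<phi> v"] by (simp add: field_simps)
    moreover have "Im (of_real a * w + of_real b) = a * Im w" for a b and w :: complex by simp
    ultimately show ?thesis by (simp only:)
  qed
  have "integral {0..0 + 2 * pi} (\<lambda>v. \<phi>' v * (Im (z' (\<phi> v) / z (\<phi> v)) * angular density (z (\<phi> v)))) = total_curvature z z'"
    unfolding total_curvature_def
    using z by (intro integral_periodic_substitution[OF _ _ _ d wrap])
      (auto intro!: continuous_intros continuous_on_angular_smooth smooth_periodic_density)
  then show "total_curvature (\<lambda>v. of_real (\<phi>' v) * z (\<phi> v))
        (\<lambda>v. of_real (\<phi>' v) * (of_real (\<phi>' v) * z' (\<phi> v)) + of_real (\<phi>'' v) * z (\<phi> v)) = total_curvature z z'"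
    unfolding total_curvature_def eq using pos by (simp add: angular_mult_of_real mult.assoc)
qed

text \<open>
  The limit velocity stays away from zero on the circle, hence so do its uniform approximations from
  some index on, and the integrands are uniformly bounded.
\<close>

lemma
  fixes z z\<^sub>1 :: "nat \<Rightarrow> real \<Rightarrow> complex"
  assumes cont: "\<And>n. continuous_on {0..2 * pi} (z n)" "\<And>n. continuous_on {0..2 * pi} (z\<^sub>1 n)"
      "continuous_on {0..2 * pi} Z" "continuous_on {0..2 * pi} Z\<^sub>1"
    and nz: "\<And>n u. z n u \<noteq> 0" "\<And>u. Z u \<noteq> 0"
    and lim: "\<epsilon> \<longlonglongrightarrow> 0"
      "eventually (\<lambda>n. \<forall>u. norm (z n u - Z u) \<le> \<epsilon> n) sequentially"
      "eventually (\<lambda>n. \<forall>u. norm (z\<^sub>1 n u - Z\<^sub>1 u) \<le> \<epsilon> n) sequentially"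
  shows velocity_length_tendsto: "(\<lambda>n. velocity_length (z n)) \<longlonglongrightarrow> velocity_length Z"
    and total_curvature_tendsto: "(\<lambda>n. total_curvature (z n) (z\<^sub>1 n)) \<longlonglongrightarrow> total_curvature Z Z\<^sub>1"
proof -
  have "continuous_on {0..2 * pi} (\<lambda>u. norm (Z u))" "continuous_on {0..2 * pi} (\<lambda>u. norm (Z\<^sub>1 u))"
    by (intro continuous_intros cont)+
  note extrema = continuous_attains_inf[OF compact_Icc _ this(1)] continuous_attains_sup[OF compact_Icc _ this(1)]
    continuous_attains_sup[OF compact_Icc _ this(2)]
  obtain u0 where u0: "\<And>u. u \<in> {0..2 * pi} \<Longrightarrow> norm (Z u0) \<le> norm (Z u)" using extrema(1) by force
  obtain u1 where u1: "\<And>u. u \<in> {0..2 * pi} \<Longrightarrow> norm (Z u) \<le> norm (Z u1)" using extrema(2) by force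
  obtain u2 where u2: "\<And>u. u \<in> {0..2 * pi} \<Longrightarrow> norm (Z\<^sub>1 u) \<le> norm (Z\<^sub>1 u2)" using extrema(3) by force
  define \<mu> where "\<mu> = norm (Z u0) / 2"
  define M where "M = norm (Z u1) + 1"
  define M1 where "M1 = norm (Z\<^sub>1 u2) + 1"
  have \<mu>: "\<mu> > 0" using nz by (simp add: \<mu>_def)
  have M: "M > 0" "M1 > 0" by (simp_all add: M_def M1_def add_nonneg_pos)
  have "eventually (\<lambda>n. \<epsilon> n < \<mu>) sequentially" "eventually (\<lambda>n. \<epsilon> n < 1) sequentially"
    using lim(1) \<mu> by (auto intro: order_tendstoD)
  then have bounds: "eventually (\<lambda>n. \<forall>u\<in>{0..2 * pi}. \<mu> \<le> norm (z n u) \<and> norm (z n u) \<le> M \<and> norm (z\<^sub>1 n u) \<le> M1) sequentially"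
    using lim(2,3)
  proof eventually_elim
    case (elim n)
    show ?case
    proof
      fix u :: real assume u: "u \<in> {0..2 * pi}"
      have close: "norm (z n u - Z u) \<le> \<epsilon> n" "norm (z\<^sub>1 n u - Z\<^sub>1 u) \<le> \<epsilon> n" using elim by auto
      have "norm (Z u) - norm (z n u) \<le> norm (z n u - Z u)"
        by (metis norm_minus_commute norm_triangle_ineq2)
      moreover have "norm (z n u) - norm (Z u) \<le> norm (z n u - Z u)"
        "norm (z\<^sub>1 n u) - norm (Z\<^sub>1 u) \<le> norm (z\<^sub>1 n u - Z\<^sub>1 u)"
        by (rule norm_triangle_ineq2)+
      ultimately show "\<mu> \<le> norm (z n u) \<and> norm (z n u) \<le> M \<and> norm (z\<^sub>1 n u) \<le> M1"
        using u0[OF u] u1[OF u] u2[OF u] elim(1,2) close unfolding \<mu>_def M_def M1_def by linarith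
    qed
  qed
  have pt: "(\<lambda>n. z n u) \<longlonglongrightarrow> Z u" "(\<lambda>n. z\<^sub>1 n u) \<longlonglongrightarrow> Z\<^sub>1 u" for u
  proof -
    have "eventually (\<lambda>n. norm (z n u - Z u) \<le> \<epsilon> n) sequentially"
      by (rule eventually_mono[OF lim(2)]) blast
    moreover have "eventually (\<lambda>n. norm (z\<^sub>1 n u - Z\<^sub>1 u) \<le> \<epsilon> n) sequentially"
      by (rule eventually_mono[OF lim(3)]) blast
    ultimately have "(\<lambda>n. z n u - Z u) \<longlonglongrightarrow> 0" "(\<lambda>n. z\<^sub>1 n u - Z\<^sub>1 u) \<longlonglongrightarrow> 0"
      by (auto intro: Lim_null_comparison[OF _ lim(1)])
    then show "(\<lambda>n. z n u) \<longlonglongrightarrow> Z u" "(\<lambda>n. z\<^sub>1 n u) \<longlonglongrightarrow> Z\<^sub>1 u" by (auto dest: LIM_zero_cancel)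
  qed
  obtain B where B: "\<And>z. \<bar>angular h z\<bar> \<le> B" "B > 0" using angular_bounded[OF smooth_periodic_h] by blast
  obtain Q where Q: "\<And>z. \<bar>angular density z\<bar> \<le> Q" "Q > 0" using angular_bounded[OF smooth_periodic_density] by blast
  show "(\<lambda>n. velocity_length (z n)) \<longlonglongrightarrow> velocity_length Z"
    unfolding velocity_length_def mink_norm_def
  proof (rule integral_tendsto_of_bounded[where B = "M * B"])
    show "eventually (\<lambda>n. \<forall>u\<in>{0..2 * pi}. \<bar>norm (z n u) * angular h (z n u)\<bar> \<le> M * B) sequentially"
      using bounds by eventually_elim (use B M in \<open>auto simp: abs_mult intro!: mult_mono\<close>)
  qed (auto intro!: continuous_intros cont tendsto_intros pt tendsto_angular continuous_on_angular_smooth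
      smooth_periodic_h nz)
  show "(\<lambda>n. total_curvature (z n) (z\<^sub>1 n)) \<longlonglongrightarrow> total_curvature Z Z\<^sub>1"
    unfolding total_curvature_def
  proof (rule integral_tendsto_of_bounded[where B = "M1 / \<mu> * Q"])
    show "eventually (\<lambda>n. \<forall>u\<in>{0..2 * pi}. \<bar>Im (z\<^sub>1 n u / z n u) * angular density (z n u)\<bar> \<le> M1 / \<mu> * Q) sequentially"
      using bounds
    proof eventually_elim
      case (elim n)
      have "\<bar>Im (z\<^sub>1 n u / z n u)\<bar> \<le> M1 / \<mu>" if "u \<in> {0..2 * pi}" for u
      proof -
        have "\<bar>Im (z\<^sub>1 n u / z n u)\<bar> \<le> norm (z\<^sub>1 n u) / norm (z n u)"
          using abs_Im_le_cmod[of "z\<^sub>1 n u / z n u"] by (simp add: norm_divide)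
        also have "\<dots> \<le> M1 / \<mu>" using elim that \<mu> M by (intro frac_le) auto
        finally show ?thesis .
      qed
      then show ?case using Q M \<mu> by (auto simp only: abs_mult intro!: mult_mono) (auto simp: less_imp_le)
    qed
  qed (auto intro!: continuous_intros cont tendsto_intros pt tendsto_angular continuous_on_angular_smooth
      smooth_periodic_density nz)
qed

text \<open>
  Convergence holds for suitably reparametrized curves only; length and total curvature do not
  notice the reparametrization and need the convergence of the first two derivatives.
\<close>

lemma
  assumes reg: "\<And>t. t \<ge> 0 \<Longrightarrow> regular_closed_curve (\<Gamma> t)"
    and conv: "converges_exponentially \<Gamma> \<gamma>"
    and \<gamma>: "smooth_fun \<gamma>" "\<And>u. vderiv \<gamma> u \<noteq> 0"
  shows mink_length_limit: "(\<lambda>n. mink_length h (\<Gamma> (real n))) \<longlonglongrightarrow> velocity_length (vderiv \<gamma>)"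
    and total_curvature_limit: "(\<lambda>n. mink_integral h (\<Gamma> (real n)) (mink_curvature h (\<Gamma> (real n))))
      \<longlonglongrightarrow> total_curvature (vderiv \<gamma>) (vderiv (vderiv \<gamma>))"
proof -
  obtain \<phi> :: "real \<Rightarrow> real \<Rightarrow> real" where \<phi>: "\<And>t. t \<ge> 0 \<Longrightarrow> circle_reparametrization (\<phi> t)"
    and ev: "\<And>m. \<exists>C. \<exists>\<delta>>0. \<forall>\<^sub>F t in at_top. \<forall>u.
           norm ((vderiv ^^ m) (\<lambda>v. \<Gamma> t (\<phi> t v) - \<gamma> v) u) \<le> C * exp (- \<delta> * t)"
    using conv unfolding converges_exponentially_def by blast
  define z where "z n v = of_real (vderiv (\<phi> (real n)) v) * vderiv (\<Gamma> (real n)) (\<phi> (real n) v)" for n v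
  define z\<^sub>1 where "z\<^sub>1 n v = of_real (vderiv (\<phi> (real n)) v) *
      (of_real (vderiv (\<phi> (real n)) v) * vderiv (vderiv (\<Gamma> (real n))) (\<phi> (real n) v))
      + of_real (vderiv (vderiv (\<phi> (real n))) v) * vderiv (\<Gamma> (real n)) (\<phi> (real n) v)" for n v
  note vel = regular_closed_curve_velocity[OF reg]
  have sm\<phi>: "smooth_fun (\<phi> (real n))" for n using \<phi>[of "real n"] by (simp add: circle_reparametrization_def)
  note d\<phi> = smooth_fun_SucD(1)[OF sm\<phi>] smooth_fun_SucD(1)[OF smooth_fun_SucD(2)[OF sm\<phi>]]
  have chain: "((\<lambda>v. f (\<phi> (real n) v)) has_vector_derivative
      of_real (vderiv (\<phi> (real n)) v) * vderiv f (\<phi> (real n) v)) (at v)"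
    if "smooth_periodic f" for n v and f :: "real \<Rightarrow> complex"
    using vector_diff_chain_at[OF d\<phi>(1) smooth_periodic_has_vector_derivative[OF that]]
    by (simp add: o_def scaleR_conv_of_real)
  have d1: "vderiv (\<lambda>v. \<Gamma> (real n) (\<phi> (real n) v) - \<gamma> v) = (\<lambda>v. z n v - vderiv \<gamma> v)" for n
    unfolding z_def
    by (intro ext vderiv_eqI has_vector_derivative_diff chain vel smooth_fun_SucD \<gamma>) simp
  have dz: "(z n has_vector_derivative z\<^sub>1 n v) (at v)" for n v
  proof -
    have "((\<lambda>v. complex_of_real (vderiv (\<phi> (real n)) v)) has_vector_derivative
        of_real (vderiv (vderiv (\<phi> (real n))) v)) (at v)"
      using d\<phi>(2) by (intro has_vector_derivative_of_real) (simp add: has_real_derivative_iff_has_vector_derivative)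
    from has_vector_derivative_mult[OF this chain[OF vel(2)]] show ?thesis
      by (simp add: z_def[abs_def] z\<^sub>1_def)
  qed
  have d2: "vderiv (\<lambda>v. z n v - vderiv \<gamma> v) = (\<lambda>v. z\<^sub>1 n v - vderiv (vderiv \<gamma>) v)" for n
    by (intro ext vderiv_eqI has_vector_derivative_diff dz smooth_fun_SucD \<gamma>)
  have seq: "\<exists>\<epsilon>. \<epsilon> \<longlonglongrightarrow> 0 \<and> eventually (\<lambda>n. \<forall>u.
      norm ((vderiv ^^ m) (\<lambda>v. \<Gamma> (real n) (\<phi> (real n) v) - \<gamma> v) u) \<le> \<epsilon> n) sequentially" for m
  proof -
    obtain C \<delta> where \<delta>: "\<delta> > 0" "\<forall>\<^sub>F t in at_top. \<forall>u.
           norm ((vderiv ^^ m) (\<lambda>v. \<Gamma> t (\<phi> t v) - \<gamma> v) u) \<le> C * exp (- \<delta> * t)"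
      using ev by blast
    have "(\<lambda>n. C * exp (- \<delta>) ^ n) \<longlonglongrightarrow> C * 0"
      using \<delta>(1) by (intro tendsto_intros LIMSEQ_power_zero) simp
    then have "(\<lambda>n. C * exp (- \<delta> * real n)) \<longlonglongrightarrow> 0"
      by (simp add: exp_of_nat_mult[symmetric] mult.commute)
    moreover have "eventually (\<lambda>n. \<forall>u. norm ((vderiv ^^ m) (\<lambda>v. \<Gamma> (real n) (\<phi> (real n) v) - \<gamma> v) u)
        \<le> C * exp (- \<delta> * real n)) sequentially"
      using eventually_compose_filterlim[OF \<delta>(2) filterlim_real_sequentially] .
    ultimately show ?thesis by blast
  qed
  obtain \<epsilon>1 where e1: "\<epsilon>1 \<longlonglongrightarrow> 0" "eventually (\<lambda>n. \<forall>u. norm (z n u - vderiv \<gamma> u) \<le> \<epsilon>1 n) sequentially"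
    using seq[of 1] by (auto simp: d1)
  obtain \<epsilon>2 where e2: "\<epsilon>2 \<longlonglongrightarrow> 0" "eventually (\<lambda>n. \<forall>u. norm (z\<^sub>1 n u - vderiv (vderiv \<gamma>) u) \<le> \<epsilon>2 n) sequentially"
    using seq[of 2] by (auto simp: d1 d2 numeral_2_eq_2)
  have e: "(\<lambda>n. max (\<epsilon>1 n) (\<epsilon>2 n)) \<longlonglongrightarrow> 0" using tendsto_max[OF e1(1) e2(1)] by simp
  have ez: "eventually (\<lambda>n. \<forall>u. norm (z n u - vderiv \<gamma> u) \<le> max (\<epsilon>1 n) (\<epsilon>2 n)) sequentially"
      "eventually (\<lambda>n. \<forall>u. norm (z\<^sub>1 n u - vderiv (vderiv \<gamma>) u) \<le> max (\<epsilon>1 n) (\<epsilon>2 n)) sequentially"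
    by (rule eventually_mono[OF e1(2)] eventually_mono[OF e2(2)]; force simp: le_max_iff_disj)+
  have contz: "continuous_on {0..2 * pi} (z n)" for n
    using dz by (meson continuous_at_imp_continuous_on has_vector_derivative_continuous)
  have cont\<phi>: "continuous_on A (\<phi> (real n))" for A n by (rule smooth_fun_continuous[OF sm\<phi>])
  have contz1: "continuous_on {0..2 * pi} (z\<^sub>1 n)" for n
    unfolding z\<^sub>1_def
    by (intro continuous_intros smooth_fun_continuous[OF smooth_fun_SucD(2)] sm\<phi> smooth_fun_SucD(2)
        continuous_on_compose2[OF smooth_periodic_continuous[of _ UNIV] cont\<phi>] smooth_periodic_vderiv vel) auto
  have nz: "z n u \<noteq> 0" for n u
    using vel(3)[of "real n"] \<phi>[of "real n"] unfolding z_def circle_reparametrization_def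
    by (metis less_irrefl mult_eq_0_iff of_nat_0_le_iff of_real_eq_0_iff)
  note cont\<gamma> = smooth_fun_continuous[OF smooth_fun_SucD(2)[OF \<gamma>(1)]]
    smooth_fun_continuous[OF smooth_fun_SucD(2)[OF smooth_fun_SucD(2)[OF \<gamma>(1)]]]
  note args = contz contz1 cont\<gamma> nz \<gamma>(2) e ez
  have rep: "circle_reparametrization (\<phi> (real n))" "continuous_on UNIV (vderiv (\<Gamma> (real n)))"
    "continuous_on UNIV (vderiv (vderiv (\<Gamma> (real n))))"
    "\<And>u. vderiv (\<Gamma> (real n)) (u + 2 * pi) = vderiv (\<Gamma> (real n)) u"
    "\<And>u. vderiv (vderiv (\<Gamma> (real n))) (u + 2 * pi) = vderiv (vderiv (\<Gamma> (real n))) u"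
    "\<And>u. vderiv (\<Gamma> (real n)) u \<noteq> 0" for n
    using vel[of "real n"] \<phi>[of "real n"] smooth_periodic_vderiv[OF vel(2)[of "real n"]]
    by (auto simp: smooth_periodic_def intro: smooth_fun_continuous)
  have "velocity_length (z n) = mink_length h (\<Gamma> (real n))" for n
    unfolding z_def[abs_def] regular_length_eq[OF reg[OF of_nat_0_le_iff]]
    by (rule velocity_length_reparametrization[OF rep])
  moreover have "total_curvature (z n) (z\<^sub>1 n) = mink_integral h (\<Gamma> (real n)) (mink_curvature h (\<Gamma> (real n)))" for n
    unfolding z_def[abs_def] z\<^sub>1_def[abs_def] regular_total_curvature_eq[OF reg[OF of_nat_0_le_iff]]
    by (rule total_curvature_reparametrization[OF rep])
  ultimately show "(\<lambda>n. mink_length h (\<Gamma> (real n))) \<longlonglongrightarrow> velocity_length (vderiv \<gamma>)"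
    "(\<lambda>n. mink_integral h (\<Gamma> (real n)) (mink_curvature h (\<Gamma> (real n))))
      \<longlonglongrightarrow> total_curvature (vderiv \<gamma>) (vderiv (vderiv \<gamma>))"
    using velocity_length_tendsto[OF args] total_curvature_tendsto[OF args] by simp_all
qed

section \<open>The isoperimetrix\<close>

definition homothetic_isoperimetrix :: "complex \<Rightarrow> real \<Rightarrow> real \<Rightarrow> complex" where
  "homothetic_isoperimetrix x\<^sub>0 l \<theta> = x\<^sub>0 + l *\<^sub>R isoperimetrix h \<theta>"

lemma vderiv_homothetic_isoperimetrix:
  "(homothetic_isoperimetrix x\<^sub>0 l has_vector_derivative of_real (- l * curvature_radius \<theta>) * cis \<theta>) (at \<theta>)"
proof -
  note sm = smooth_h smooth_fun_SucD(2)[OF smooth_h]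
  have "((\<lambda>\<theta>. x\<^sub>0 + of_real l * (- (of_real (vderiv h \<theta>) * cis \<theta>) + of_real (h \<theta>) * (\<i> * cis \<theta>)))
      has_vector_derivative 0 + of_real l * (- (of_real (vderiv h \<theta>) * (\<i> * cis \<theta>) + of_real (vderiv (vderiv h) \<theta>) * cis \<theta>)
        + (of_real (h \<theta>) * (\<i> * (\<i> * cis \<theta>)) + of_real (vderiv h \<theta>) * (\<i> * cis \<theta>)))) (at \<theta>)"
    by (intro has_vector_derivative_add has_vector_derivative_mult_right has_vector_derivative_minus
        has_vector_derivative_mult has_vector_derivative_const has_vector_derivative_cis
        has_vector_derivative_of_real_vderiv sm)
  then show ?thesis
    by (simp add: homothetic_isoperimetrix_def[abs_def] isoperimetrix_def scaleR_conv_of_real algebra_simps)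
qed

lemma smooth_fun_homothetic_isoperimetrix: "smooth_fun (homothetic_isoperimetrix x\<^sub>0 l)"
proof (rule smooth_funI[OF vderiv_homothetic_isoperimetrix])
  have "smooth_fun curvature_radius"
    using smooth_periodic_curvature_radius by (simp add: smooth_periodic_def)
  then show "smooth_fun (\<lambda>\<theta>. of_real (- l * curvature_radius \<theta>) * cis \<theta>)"
    by (intro smooth_fun_mult smooth_fun_cis smooth_fun_of_real smooth_fun_const)
qed

lemma homothetic_isoperimetrix_velocity:
  "vderiv (homothetic_isoperimetrix x\<^sub>0 l) = (\<lambda>\<theta>. of_real (- l * curvature_radius \<theta>) * cis \<theta>)"
  by (intro ext vderiv_eqI vderiv_homothetic_isoperimetrix)

text \<open>
  On the isoperimetrix the pairing of the position with the rotated velocity is \<open>- h (h + h'')\<close>; the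
  centre \<open>x\<^sub>0\<close> contributes the integral of a derivative.
\<close>

lemma area_homothetic_isoperimetrix:
  "enclosed_area (homothetic_isoperimetrix x\<^sub>0 l) = l\<^sup>2 / 2 * integral {0..2 * pi} density"
proof -
  let ?r = curvature_radius
  have \<open>homothetic_isoperimetrix x\<^sub>0 l \<theta> \<bullet> (\<i> * (of_real (- l * ?r \<theta>) * cis \<theta>))
      = x\<^sub>0 \<bullet> (\<i> * (of_real (- l * ?r \<theta>) * cis \<theta>)) - l\<^sup>2 * density \<theta>\<close> for \<theta>
  proof -
    have "isoperimetrix h \<theta> \<bullet> (\<i> * cis \<theta>) = h \<theta> * (cos \<theta> * cos \<theta>) + h \<theta> * (sin \<theta> * sin \<theta>)"
      by (simp add: isoperimetrix_def inner_complex_def algebra_simps)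
    also have "\<dots> = h \<theta> * ((cos \<theta>)\<^sup>2 + (sin \<theta>)\<^sup>2)"
      by (simp only: power2_eq_square distrib_left)
    finally have "isoperimetrix h \<theta> \<bullet> (\<i> * cis \<theta>) = h \<theta>" by simp
    moreover have "\<i> * (of_real c * cis \<theta>) = c *\<^sub>R (\<i> * cis \<theta>)" for c
      by (simp add: scaleR_conv_of_real)
    ultimately have "isoperimetrix h \<theta> \<bullet> (\<i> * (of_real c * cis \<theta>)) = c * h \<theta>" for c
      by (simp only: inner_scaleR_right)
    then show ?thesis
      by (simp only: homothetic_isoperimetrix_def inner_add_left inner_scaleR_left)
        (simp add: density_def power2_eq_square)
  qed
  then have "enclosed_area (homothetic_isoperimetrix x\<^sub>0 l) = - (1 / 2) * integral {0..2 * pi}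
      (\<lambda>\<theta>. x\<^sub>0 \<bullet> (\<i> * (of_real (- l * ?r \<theta>) * cis \<theta>)) - l\<^sup>2 * density \<theta>)"
    by (simp only: enclosed_area_eq homothetic_isoperimetrix_velocity)
  moreover have "((\<lambda>\<theta>. x\<^sub>0 \<bullet> (\<i> * (of_real (- l * ?r \<theta>) * cis \<theta>)) - l\<^sup>2 * density \<theta>) has_integral
      0 - l\<^sup>2 * integral {0..2 * pi} density) {0..2 * pi}"
  proof (intro has_integral_diff has_integral_mult_right)
    have per: "homothetic_isoperimetrix x\<^sub>0 l (2 * pi) = homothetic_isoperimetrix x\<^sub>0 l 0"
    proof -
      have "h (0 + 2 * pi) = h 0" "vderiv h (0 + 2 * pi) = vderiv h 0"
        using smooth_periodic_h smooth_periodic_vderiv[OF smooth_periodic_h]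
        unfolding smooth_periodic_def by blast+
      then show ?thesis by (simp add: homothetic_isoperimetrix_def isoperimetrix_def)
    qed
    have "((\<lambda>\<theta>. x\<^sub>0 \<bullet> (\<i> * homothetic_isoperimetrix x\<^sub>0 l \<theta>)) has_vector_derivative
        x\<^sub>0 \<bullet> (\<i> * (of_real (- l * ?r \<theta>) * cis \<theta>))) (at \<theta>)" for \<theta>
      by (intro bounded_linear.has_vector_derivative[OF bounded_linear_inner_right]
          has_vector_derivative_mult_right vderiv_homothetic_isoperimetrix)
    then have "((\<lambda>\<theta>. x\<^sub>0 \<bullet> (\<i> * (of_real (- l * ?r \<theta>) * cis \<theta>))) has_integral
        x\<^sub>0 \<bullet> (\<i> * homothetic_isoperimetrix x\<^sub>0 l (2 * pi)) - x\<^sub>0 \<bullet> (\<i> * homothetic_isoperimetrix x\<^sub>0 l 0)) {0..2 * pi}"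
      by (intro fundamental_theorem_of_calculus) (auto intro: has_vector_derivative_at_within)
    then show "((\<lambda>\<theta>. x\<^sub>0 \<bullet> (\<i> * (of_real (- l * ?r \<theta>) * cis \<theta>))) has_integral 0) {0..2 * pi}"
      by (simp only: per diff_self)
    show "(density has_integral integral {0..2 * pi} density) {0..2 * pi}"
      by (intro integrable_integral integrable_continuous_interval smooth_periodic_continuous smooth_periodic_density)
  qed
  ultimately show ?thesis by (simp add: integral_unique)
qed

lemma integral_density: "integral {0..2 * pi} density = 2 * enclosed_area (isoperimetrix h)"
proof -
  have "homothetic_isoperimetrix 0 1 = isoperimetrix h"
    by (simp add: homothetic_isoperimetrix_def[abs_def])
  then show ?thesis using area_homothetic_isoperimetrix[of 0 1] by simp
qed

text \<open>
  The velocity of the isoperimetrix at angle \<open>\<theta>\<close> has direction \<open>\<theta> + \<pi>\<close>, which is as good as \<open>\<theta>\<close>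
  because the unit ball is centrally symmetric. So the tangent turns at unit speed, and both
  integrals reduce to that of \<open>h (h + h'')\<close>, twice the area.
\<close>

lemma homothetic_isoperimetrix_limits:
  assumes "l > 0"
  shows "velocity_length (vderiv (homothetic_isoperimetrix x\<^sub>0 l)) = 2 * l * enclosed_area (isoperimetrix h)"
    and "total_curvature (vderiv (homothetic_isoperimetrix x\<^sub>0 l)) (vderiv (vderiv (homothetic_isoperimetrix x\<^sub>0 l)))
      = 2 * enclosed_area (isoperimetrix h)"
proof -
  let ?r = curvature_radius
  let ?Z = "\<lambda>\<theta>. of_real (- l * ?r \<theta>) * cis \<theta> :: complex"
  have r: "?r \<theta> > 0" for \<theta> by (rule convex)
  have per: "vderiv (vderiv h) (\<theta> + pi) = vderiv (vderiv h) \<theta>" "h (\<theta> + pi) = h \<theta>" for \<theta>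
  proof -
    note s = smooth_fun_SucD[OF smooth_h] 
    have "vderiv h (\<theta> + pi) = vderiv h \<theta>" for \<theta>
      by (rule vderiv_periodic[OF _ s(1)]) (simp add: h_pi)
    then have "vderiv (vderiv h) (\<theta> + pi) = vderiv (vderiv h) \<theta>"
      by (intro vderiv_periodic[OF _ smooth_fun_SucD(1)[OF s(2)]]) simp
    then show "vderiv (vderiv h) (\<theta> + pi) = vderiv (vderiv h) \<theta>" "h (\<theta> + pi) = h \<theta>" by (simp_all add: h_pi)
  qed
  have dir: "?Z \<theta> = of_real (l * ?r \<theta>) * cis (\<theta> + pi)" for \<theta>
    by (simp add: cis_mult[symmetric])
  have ang: "angular q (?Z \<theta>) = q (\<theta> + pi)" if "smooth_periodic q" for q :: "real \<Rightarrow> real" and \<theta>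
    unfolding dir using that assms r by (intro angular_cis) (auto simp: smooth_periodic_def)
  have "mink_norm h (?Z \<theta>) = l * density \<theta>" for \<theta>
    using assms r[of \<theta>]
    by (simp only: mink_norm_def ang[OF smooth_periodic_h] per density_def)
      (simp add: norm_mult[of "of_real _"] abs_mult del: of_real_mult of_real_minus of_real_add)
  then show "velocity_length (vderiv (homothetic_isoperimetrix x\<^sub>0 l)) = 2 * l * enclosed_area (isoperimetrix h)"
    using integral_density by (simp add: velocity_length_def homothetic_isoperimetrix_velocity)
  have sr: "smooth_fun (\<lambda>\<theta>. - l * ?r \<theta>)"
    using smooth_periodic_curvature_radius
    by (intro smooth_fun_mult smooth_fun_const) (simp add: smooth_periodic_def)
  have "vderiv ?Z \<theta> = of_real (- l * ?r \<theta>) * (\<i> * cis \<theta>) + of_real (vderiv (\<lambda>\<theta>. - l * ?r \<theta>) \<theta>) * cis \<theta>" for \<theta>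
    by (intro vderiv_eqI has_vector_derivative_mult has_vector_derivative_cis
        has_vector_derivative_of_real_vderiv sr)
  note dZ = this
  have "vderiv ?Z \<theta> / ?Z \<theta> = \<i> + of_real (vderiv (\<lambda>\<theta>. - l * ?r \<theta>) \<theta> / (- l * ?r \<theta>))" for \<theta>
  proof -
    have quot: "(of_real a * (\<i> * c) + of_real b * c) / (of_real a * c) = \<i> + of_real (b / a)"
      if "a \<noteq> 0" "c \<noteq> 0" for a b and c :: complex
      using that by (simp add: add_divide_distrib)
    have "- l * ?r \<theta> \<noteq> 0" using assms r[of \<theta>] by simp
    then show ?thesis
      using dZ[of \<theta>] quot[OF _ cis_neq_zero] by (simp only:)
  qed
  then have "Im (vderiv ?Z \<theta> / ?Z \<theta>) = 1" for \<theta>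
    by (simp only: plus_complex.sel Im_complex_of_real imaginary_unit.sel)
  moreover have "angular density (?Z \<theta>) = density \<theta>" for \<theta>
    by (simp only: ang[OF smooth_periodic_density] density_def per)
  ultimately show "total_curvature (vderiv (homothetic_isoperimetrix x\<^sub>0 l)) (vderiv (vderiv (homothetic_isoperimetrix x\<^sub>0 l)))
      = 2 * enclosed_area (isoperimetrix h)"
    by (simp only: total_curvature_def homothetic_isoperimetrix_velocity mult_1 integral_density)
qed

end

section \<open>First variation along the flow\<close>

lemma has_vector_derivative_quotient:
  fixes f g :: "real \<Rightarrow> 'a::real_normed_field"
  assumes "(f has_vector_derivative f') (at x within S)" "(g has_vector_derivative g') (at x within S)" "g x \<noteq> 0"
  shows "((\<lambda>x. f x / g x) has_vector_derivative f' / g x - f x / g x * (g' / g x)) (at x within S)"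
  using has_vector_derivative_mult[OF assms(1) has_vector_derivative_inverse[OF assms(2,3)]]
  by (simp add: divide_inverse algebra_simps)

context minkowski_plane
begin

text \<open>
  The gradient of the norm \<open>mink_norm h\<close> at a vector of angle \<open>x\<close>. Multiplied by \<open>\<i>\<close> it is the point
  of the isoperimetrix at angle \<open>x\<close>, that is, the Minkowski normal.
\<close>

definition norm_gradient :: "real \<Rightarrow> complex" where
  "norm_gradient x = (of_real (h x) + \<i> * of_real (vderiv h x)) * cis x"

lemma has_vector_derivative_norm_gradient:
  "(norm_gradient has_vector_derivative \<i> * of_real (curvature_radius x) * cis x) (at x)"
proof -
  have "(norm_gradient has_vector_derivative (of_real (h x) + \<i> * of_real (vderiv h x)) * (\<i> * cis x)
      + (of_real (vderiv h x) + \<i> * of_real (vderiv (vderiv h) x)) * cis x) (at x)"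
    unfolding norm_gradient_def[abs_def]
    by (intro has_vector_derivative_mult has_vector_derivative_add has_vector_derivative_mult_right
        has_vector_derivative_of_real_vderiv has_vector_derivative_cis smooth_h smooth_fun_SucD(2))
  then show ?thesis by (simp add: algebra_simps)
qed

lemma norm_gradient_periodic: "norm_gradient (x + 2 * pi) = norm_gradient x"
  using smooth_periodic_h smooth_periodic_vderiv[OF smooth_periodic_h]
  by (simp add: norm_gradient_def smooth_periodic_def flip: cis_mult)

lemma has_vector_derivative_angular_norm_gradient:
  assumes "(z has_vector_derivative z') (at u within S)" and "z u \<noteq> 0"
  shows "((\<lambda>u. angular norm_gradient (z u)) has_vector_derivative
    Im (z' / z u) *\<^sub>R (\<i> * of_real (angular curvature_radius (z u)) * cis (Arg (z u)))) (at u within S)"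
  using has_vector_derivative_angular[OF _ has_vector_derivative_norm_gradient assms] norm_gradient_periodic
  by (simp add: angular_def)

lemma has_vector_derivative_mink_norm:
  assumes z: "(z has_vector_derivative z') (at u within S)" and nz: "z u \<noteq> 0"
  shows "((\<lambda>u. mink_norm h (z u)) has_vector_derivative angular norm_gradient (z u) \<bullet> z') (at u within S)"
proof -
  let ?a = "angular h (z u)" and ?b = "angular (vderiv h) (z u)"
  have "((\<lambda>u. angular h (z u)) has_vector_derivative Im (z' / z u) *\<^sub>R ?b) (at u within S)"
    using smooth_periodic_h by (intro has_vector_derivative_angular z nz)
      (auto simp: smooth_periodic_def intro: smooth_fun_SucD)
  from has_vector_derivative_mult[OF has_vector_derivative_norm[OF z nz] this]
  have "((\<lambda>u. mink_norm h (z u)) has_vector_derivative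
      norm (z u) * (Im (z' / z u) * ?b) + norm (z u) * Re (z' / z u) * ?a) (at u within S)"
    by (simp add: mink_norm_def)
  moreover have "angular norm_gradient (z u) \<bullet> z' = norm (z u) * (Im (z' / z u) * ?b) + norm (z u) * Re (z' / z u) * ?a"
  proof -
    let ?w = "z' / z u"
    have zs: "z' = of_real (norm (z u)) * (?w * sgn (z u))"
      using nz by (simp add: sgn_eq)
    have "angular norm_gradient (z u) = (of_real ?a + \<i> * of_real ?b) * sgn (z u)"
      using nz by (simp add: angular_def norm_gradient_def cis_Arg)
    moreover have "((of_real a + \<i> * of_real b) * s) \<bullet> (of_real r * (w * s)) = r * (norm s)\<^sup>2 * (Re w * a + Im w * b)"
      for a b r and s w :: complex
      unfolding cmod_power2 by (simp add: inner_complex_def power2_eq_square algebra_simps)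
    ultimately have "angular norm_gradient (z u) \<bullet> z' = norm (z u) * (norm (sgn (z u)))\<^sup>2 * (Re ?w * ?a + Im ?w * ?b)"
      by (subst zs) (simp only:)
    then show ?thesis using nz by (simp add: norm_sgn algebra_simps)
  qed
  ultimately show ?thesis by simp
qed

end

text \<open>
  A flow that exists for all time, together with a choice of its partial derivatives: \<open>D i j\<close> is of
  order \<open>i\<close> in time and \<open>j\<close> in the parameter. Thus \<open>D 0 1\<close> is the velocity \<open>z\<close>, \<open>D 0 2\<close> its parameter
  derivative and \<open>D 1 0\<close> the variation field.
\<close>

locale polyharmonic_evolution = minkowski_plane +
  fixes p :: nat and \<Gamma> :: "real \<Rightarrow> real \<Rightarrow> complex" and D :: "nat \<Rightarrow> nat \<Rightarrow> real \<Rightarrow> real \<Rightarrow> complex"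
  assumes regular: "t \<ge> 0 \<Longrightarrow> regular_closed_curve (\<Gamma> t)"
    and D_00: "t \<ge> 0 \<Longrightarrow> D 0 0 t u = \<Gamma> t u"
    and D_continuous: "continuous_on ({0..} \<times> UNIV) (\<lambda>(t, u). D i j t u)"
    and D_parameter: "t \<ge> 0 \<Longrightarrow> (D i j t has_vector_derivative D i (Suc j) t u) (at u)"
    and D_time: "t \<ge> 0 \<Longrightarrow> ((\<lambda>s. D i j s u) has_vector_derivative D (Suc i) j t u) (at t within {0..})"
    and evolution: "t \<ge> 0 \<Longrightarrow> ((\<lambda>s. \<Gamma> s u) has_vector_derivative
      ((-1) ^ p * mink_curvature_deriv h (\<Gamma> t) (2 * p) u) *\<^sub>R mink_normal h (\<Gamma> t) u) (at t within {0..})"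
begin

lemma velocity_eq: "t \<ge> 0 \<Longrightarrow> vderiv (\<Gamma> t) = D 0 1 t"
proof -
  assume t: "t \<ge> 0"
  have "\<Gamma> t = D 0 0 t" using D_00[OF t] by auto
  then show "vderiv (\<Gamma> t) = D 0 1 t" using D_parameter[OF t, of 0 0] by (auto intro!: vderiv_eqI)
qed

lemma acceleration_eq: "t \<ge> 0 \<Longrightarrow> vderiv (D 0 (Suc 0) t) = D 0 2 t"
  using D_parameter[of t 0 1] by (auto intro!: vderiv_eqI simp: numeral_2_eq_2)

lemma minkowski_curve_at: "t \<ge> 0 \<Longrightarrow> minkowski_curve h (\<Gamma> t)"
  by unfold_locales (rule regular)

lemma velocity_nonzero: "t \<ge> 0 \<Longrightarrow> D 0 1 t u \<noteq> 0"
  using regular_closed_curve_velocity(3)[OF regular[of t]] by (simp add: velocity_eq)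

definition speed :: "real \<Rightarrow> real \<Rightarrow> real" where
  "speed t u = (-1) ^ p * mink_curvature_deriv h (\<Gamma> t) (2 * p) u"

lemma D_10: "D (Suc 0) 0 t u = speed t u *\<^sub>R (\<i> * angular norm_gradient (D 0 1 t u))" if t: "t \<ge> 0"
proof -
  interpret c: minkowski_curve h "\<Gamma> t" by (rule minkowski_curve_at[OF t])
  have "((\<lambda>s. \<Gamma> s u) has_vector_derivative D (Suc 0) 0 t u) (at t within {0..})"
    using D_time[OF t, of 0 0 u] t D_00
    by (intro has_vector_derivative_transform[of t "{0..}" "\<lambda>s. \<Gamma> s u" "\<lambda>s. D 0 0 s u"]) auto
  moreover have "t islimpt {0..}"
  proof (rule connected_imp_perfect)
    show "{0..} \<noteq> {x}" for x :: real
      by (metis atLeast_iff le_add_same_cancel1 less_add_one less_imp_le not_less order_refl singletonD)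
  qed (use t in auto)
  then have "at t within {0..} \<noteq> bot"
    by (simp add: trivial_limit_within)
  ultimately have "D (Suc 0) 0 t u = speed t u *\<^sub>R mink_normal h (\<Gamma> t) u"
    using evolution[OF t, of u] vector_derivative_unique_within unfolding speed_def by blast
  then show ?thesis
    using velocity_nonzero[OF t]
    by (simp add: c.mink_normal_eq velocity_eq t angular_def norm_gradient_def cis_Arg mult.assoc)
qed

lemma D_periodic: "D 0 j t (u + 2 * pi) = D 0 j t u" "D (Suc 0) j t (u + 2 * pi) = D (Suc 0) j t u" if t: "t \<ge> 0"
proof -
  interpret c: minkowski_curve h "\<Gamma> t" by (rule minkowski_curve_at[OF t])
  have step: "D i (Suc j) t (u + 2 * pi) = D i (Suc j) t u" if "\<And>u. D i j t (u + 2 * pi) = D i j t u" for i j u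
  proof -
    have "vderiv (D i j t) = D i (Suc j) t" using D_parameter[OF t] by (auto intro!: vderiv_eqI)
    then show ?thesis using vderiv_periodic[of "D i j t" "2 * pi" u] that D_parameter[OF t, of i j] by auto
  qed
  have "\<Gamma> t (u + 2 * pi) = \<Gamma> t u" for u using c.velocity(1) by (simp add: smooth_periodic_def)
  then have per0: "D 0 j t (u + 2 * pi) = D 0 j t u" for j u
    by (induction j arbitrary: u) (auto simp: D_00 t intro: step)
  have "speed t (u + 2 * pi) = speed t u" for u
    using c.smooth_periodic_mink_curvature_deriv[of "2 * p"] by (simp add: speed_def smooth_periodic_def)
  then have "D (Suc 0) j t (u + 2 * pi) = D (Suc 0) j t u" for j u
    by (induction j arbitrary: u) (auto simp: D_10[OF t] per0 intro: step)
  then show "D 0 j t (u + 2 * pi) = D 0 j t u" "D (Suc 0) j t (u + 2 * pi) = D (Suc 0) j t u" using per0 by auto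
qed

lemma D_continuous_param [continuous_intros]: "continuous_on ({0..} \<times> A) (\<lambda>x. D i j (fst x) (snd x))"
  using continuous_on_subset[OF D_continuous[of i j], of "{0..} \<times> A"] by (auto simp: split_beta)

lemma D_continuous_on: "t \<ge> 0 \<Longrightarrow> continuous_on A (D i j t)"
  using D_parameter by (meson continuous_at_imp_continuous_on has_vector_derivative_continuous)

text \<open>The rate at which the flow loses length.\<close>

definition energy :: "real \<Rightarrow> real" where
  "energy t = mink_integral h (\<Gamma> t) (\<lambda>u. (mink_curvature_deriv h (\<Gamma> t) p u)\<^sup>2)"

lemma energy_nonneg:
  assumes t: "t \<ge> 0"
  shows "energy t \<ge> 0"
proof -
  interpret c: minkowski_curve h "\<Gamma> t" by (rule minkowski_curve_at[OF t])
  show ?thesis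
    unfolding energy_def c.mink_integral_eq
    by (intro integral_nonneg integrable_continuous_interval smooth_periodic_continuous
        smooth_periodic_mult smooth_periodic_power2 c.smooth_periodic_mink_curvature_deriv c.smooth_periodic_weight)
      (simp add: c.weight_pos less_imp_le)
qed

text \<open>
  Moving the parameter derivative from the variation \<open>\<Gamma>\<^sub>t\<close> to the gradient of the norm turns the
  variation of length into \<open>- \<integral> F \<kappa> d\<sigma>\<close>, where \<open>F\<close> is the normal speed; integrating by parts
  \<open>p\<close> more times gives the square of \<open>\<kappa>\<^sub>\<sigma>\<^sup>p\<close>.
\<close>

lemma length_decay:
  assumes t: "t \<ge> 0"
  shows "((\<lambda>s. mink_length h (\<Gamma> s)) has_vector_derivative - energy t) (at t within {0..})"
proof -
  let ?G = "\<lambda>t u. angular norm_gradient (D 0 1 t u)"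
  have cont: "continuous_on ({0..} \<times> {0..2 * pi}) (\<lambda>x. ?G (fst x) (snd x) \<bullet> D 1 1 (fst x) (snd x))"
    using norm_gradient_periodic has_vector_derivative_norm_gradient velocity_nonzero
    by (intro continuous_intros continuous_on_angular) auto
  have "((\<lambda>s. integral (cbox 0 (2 * pi)) (\<lambda>u. mink_norm h (D 0 1 s u))) has_vector_derivative
      integral (cbox 0 (2 * pi)) (\<lambda>u. ?G t u \<bullet> D 1 1 t u)) (at t within {0..})"
  proof (rule leibniz_rule_vector_derivative)
    show "((\<lambda>s. mink_norm h (D 0 1 s u)) has_vector_derivative ?G s u \<bullet> D 1 1 s u) (at s within {0..})"
      if "s \<in> {0..}" for s u
      using that D_time[of s 0 1 u] velocity_nonzero by (intro has_vector_derivative_mink_norm) auto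
    show "(\<lambda>u. mink_norm h (D 0 1 s u)) integrable_on cbox 0 (2 * pi)" if "s \<in> {0..}" for s
      using that velocity_nonzero unfolding mink_norm_def
      by (intro integrable_continuous continuous_intros continuous_on_angular_smooth smooth_periodic_h
          D_continuous_on) auto
  qed (use cont t in \<open>auto simp: split_beta\<close>)
  then have "((\<lambda>s. mink_length h (\<Gamma> s)) has_vector_derivative
      integral {0..2 * pi} (\<lambda>u. ?G t u \<bullet> D 1 1 t u)) (at t within {0..})"
    using t by (intro has_vector_derivative_transform[of t "{0..}" "\<lambda>s. mink_length h (\<Gamma> s)"
          "\<lambda>s. integral (cbox 0 (2 * pi)) (\<lambda>u. mink_norm h (D 0 1 s u))"])
      (auto simp: regular_length_eq[OF regular] velocity_length_def velocity_eq)
  moreover have "integral {0..2 * pi} (\<lambda>u. ?G t u \<bullet> D 1 1 t u) = - energy t"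
  proof -
    interpret c: minkowski_curve h "\<Gamma> t" by (rule minkowski_curve_at[OF t])
    let ?\<kappa> = "mink_curvature h (\<Gamma> t)"
    define G' where "G' u = Im (D 0 2 t u / D 0 1 t u) *\<^sub>R
      (\<i> * of_real (angular curvature_radius (D 0 1 t u)) * cis (Arg (D 0 1 t u)))" for u
    have dG: "(?G t has_vector_derivative G' u) (at u)" for u
      unfolding G'_def using D_parameter[OF t, of 0 1 u] velocity_nonzero[OF t]
      by (intro has_vector_derivative_angular_norm_gradient) (auto simp: numeral_2_eq_2)
    have "((\<lambda>u. ?G t u \<bullet> D 1 0 t u) has_vector_derivative ?G t u \<bullet> D 1 1 t u + G' u \<bullet> D 1 0 t u) (at u)" for u
      using bounded_bilinear.has_vector_derivative[OF bounded_bilinear_inner dG D_parameter[OF t, of 1 0]]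
      by simp
    then have zero: "integral {0..2 * pi} (\<lambda>u. ?G t u \<bullet> D 1 1 t u + G' u \<bullet> D 1 0 t u) = 0"
      by (rule integral_periodic_derivative) (simp_all add: D_periodic[OF t])
    have "G' u \<bullet> D 1 0 t u = speed t u * (?\<kappa> u * c.weight u)" for u
    proof -
      have eq: "(x *\<^sub>R (\<i> * of_real a * c)) \<bullet> (y *\<^sub>R (\<i> * ((of_real b + \<i> * of_real b') * c)))
        = y * (x * a * b) * ((Re c)\<^sup>2 + (Im c)\<^sup>2)" for x y a b b' :: real and c
        by (simp add: inner_complex_def power2_eq_square algebra_simps)
      show ?thesis
        unfolding G'_def D_10[OF t, folded One_nat_def] unfolding angular_def norm_gradient_def eq
        using velocity_nonzero[OF t, of u]
        by (simp add: c.mink_curvature_eq velocity_eq acceleration_eq t c.weight_def mink_norm_def angular_def)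
    qed
    then have G'V: "(\<lambda>u. G' u \<bullet> D 1 0 t u) = (\<lambda>u. speed t u * (?\<kappa> u * c.weight u))" by auto
    have sp: "smooth_periodic (speed t)"
      unfolding speed_def[abs_def]
      by (intro smooth_periodic_mult c.smooth_periodic_mink_curvature_deriv)
        (simp add: smooth_periodic_def smooth_fun_const)
    have int: "(\<lambda>u. G' u \<bullet> D 1 0 t u) integrable_on {0..2 * pi}"
      unfolding G'V by (intro integrable_continuous_interval smooth_periodic_continuous smooth_periodic_mult
          sp c.smooth_periodic_mink_curvature c.smooth_periodic_weight)
    have "(\<lambda>u. ?G t u \<bullet> D 1 1 t u) integrable_on {0..2 * pi}"
      using dG by (intro integrable_continuous_interval continuous_intros D_continuous_on t)
        (meson continuous_at_imp_continuous_on has_vector_derivative_continuous)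
    with int zero have "integral {0..2 * pi} (\<lambda>u. ?G t u \<bullet> D 1 1 t u) = - integral {0..2 * pi} (\<lambda>u. G' u \<bullet> D 1 0 t u)"
      by (simp add: integral_add)
    also have "integral {0..2 * pi} (\<lambda>u. G' u \<bullet> D 1 0 t u)
        = (-1) ^ p * mink_integral h (\<Gamma> t) (\<lambda>u. ?\<kappa> u * mink_curvature_deriv h (\<Gamma> t) (2 * p) u)"
      unfolding G'V c.mink_integral_eq speed_def integral_mult_right[symmetric]
      by (simp add: mult_ac)
    also have "\<dots> = energy t"
      by (simp add: c.mink_integral_curvature_parts energy_def flip: power_mult_distrib mult.assoc)
    finally show ?thesis .
  qed
  ultimately show ?thesis by simp
qed

text \<open>
  With \<open>q = h (h + h'')\<close>, the integrand of \<open>\<integral>\<kappa> d\<sigma>\<close> is \<open>\<theta>\<^sub>u q(\<theta>)\<close>, and its time derivative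
  is the parameter derivative of \<open>\<theta>\<^sub>t q(\<theta>)\<close>. The integral of the latter over a period vanishes,
  whatever the evolution of the closed curve is.
\<close>

lemma total_curvature_constant:
  assumes t: "t \<ge> 0"
  shows "mink_integral h (\<Gamma> t) (mink_curvature h (\<Gamma> t)) = mink_integral h (\<Gamma> 0) (mink_curvature h (\<Gamma> 0))"
proof -
  let ?q = "\<lambda>t u. angular density (D 0 1 t u)" and ?q' = "\<lambda>t u. angular (vderiv density) (D 0 1 t u)"
  let ?K = "\<lambda>t. integral (cbox 0 (2 * pi)) (\<lambda>u. Im (D 0 2 t u / D 0 1 t u) * ?q t u)"
  define k where "k t u = Im (D 0 2 t u / D 0 1 t u) * (Im (D 1 1 t u / D 0 1 t u) * ?q' t u)
      + Im (D 1 2 t u / D 0 1 t u - D 0 2 t u / D 0 1 t u * (D 1 1 t u / D 0 1 t u)) * ?q t u" for t u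
  note q = smooth_periodic_density smooth_periodic_vderiv[OF smooth_periodic_density]
  have dq: "((\<lambda>x. angular density (z x)) has_vector_derivative Im (z' / z x) * angular (vderiv density) (z x)) (at x within S)"
    if "(z has_vector_derivative z') (at x within S)" "z x \<noteq> 0" for z z' x S
    using has_vector_derivative_angular[of density "vderiv density", OF _ _ that] q(1)
    by (auto simp: smooth_periodic_def smooth_fun_SucD)
  have "(?K has_vector_derivative 0) (at s within {0..})" if s: "s \<ge> 0" for s
  proof -
    have "(?K has_vector_derivative integral (cbox 0 (2 * pi)) (k s)) (at s within {0..})"
    proof (rule leibniz_rule_vector_derivative)
      show "((\<lambda>t. Im (D 0 2 t u / D 0 1 t u) * ?q t u) has_vector_derivative k t u) (at t within {0..})"
        if "t \<in> {0..}" for t u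
        unfolding k_def
        using that D_time[of t 0 1 u] D_time[of t 0 2 u] velocity_nonzero[of t u]
        by (intro has_vector_derivative_mult dq bounded_linear.has_vector_derivative[OF bounded_linear_Im]
            has_vector_derivative_quotient) auto
      show "(\<lambda>u. Im (D 0 2 t u / D 0 1 t u) * ?q t u) integrable_on cbox 0 (2 * pi)" if "t \<in> {0..}" for t
        using that velocity_nonzero
        by (intro integrable_continuous continuous_intros continuous_on_angular_smooth q D_continuous_on) auto
      show "continuous_on ({0..} \<times> cbox 0 (2 * pi)) (\<lambda>(t, u). k t u)"
        unfolding k_def split_beta using velocity_nonzero
        by (intro continuous_intros continuous_on_angular_smooth q) auto
    qed (use s in auto)
    moreover have "((\<lambda>u. Im (D 1 1 s u / D 0 1 s u) * ?q s u) has_vector_derivative k s u) (at u)" for u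
    proof -
      have "((\<lambda>u. Im (D 1 1 s u / D 0 1 s u) * ?q s u) has_vector_derivative
          Im (D 1 1 s u / D 0 1 s u) * (Im (D 0 2 s u / D 0 1 s u) * ?q' s u)
          + Im (D 1 2 s u / D 0 1 s u - D 1 1 s u / D 0 1 s u * (D 0 2 s u / D 0 1 s u)) * ?q s u) (at u)"
        using D_parameter[OF s, of 1 1 u] D_parameter[OF s, of 0 1 u] velocity_nonzero[OF s, of u]
        by (intro has_vector_derivative_mult dq bounded_linear.has_vector_derivative[OF bounded_linear_Im]
            has_vector_derivative_quotient) (auto simp: numeral_2_eq_2)
      then show ?thesis by (simp only: k_def mult.commute mult.left_commute)
    qed
    then have "integral {0..2 * pi} (k s) = 0"
      by (rule integral_periodic_derivative) (simp_all add: D_periodic[OF s])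
    ultimately show ?thesis by simp
  qed
  then obtain c where "\<And>s. s \<ge> 0 \<Longrightarrow> ?K s = c"
    using has_vector_derivative_zero_constant[of "{0..}" ?K] by auto
  then have "?K t = ?K 0" using t by simp
  then show ?thesis
    using t by (simp add: regular_total_curvature_eq[OF regular] total_curvature_def velocity_eq acceleration_eq)
qed

section \<open>The times at which the curve is not convex\<close>

definition nonconvex_times :: "real set" where
  "nonconvex_times = {t. 0 \<le> t \<and> (\<exists>u. mink_curvature h (\<Gamma> t) u \<le> 0)}"

text \<open>
  The curvature is continuous in time and parameter jointly, and the parameter may be restricted to a
  compact interval; projections along compact sets preserve closedness.
\<close>

lemma closed_nonconvex_times: "closed nonconvex_times"
proof -
  define \<kappa> where "\<kappa> x = Im (D 0 2 (snd x) (fst x) / D 0 1 (snd x) (fst x)) / norm (D 0 1 (snd x) (fst x))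
    * angular curvature_radius (D 0 1 (snd x) (fst x))" for x
  have \<kappa>: "mink_curvature h (\<Gamma> t) u = \<kappa> (u, t)" if t: "t \<ge> 0" for t u
  proof -
    interpret c: minkowski_curve h "\<Gamma> t" by (rule minkowski_curve_at[OF t])
    show ?thesis by (simp add: c.mink_curvature_eq \<kappa>_def velocity_eq acceleration_eq t)
  qed
  have D: "continuous_on ({0..2 * pi} \<times> {0..}) (\<lambda>x. D i j (snd x) (fst x))" for i j
    by (rule continuous_on_compose2[OF D_continuous_param[of UNIV i j], of _ "\<lambda>x. (snd x, fst x)", simplified])
      (auto intro!: continuous_intros)
  have "continuous_on ({0..2 * pi} \<times> {0..}) \<kappa>"
    unfolding \<kappa>_def[abs_def] using velocity_nonzero
    by (intro continuous_intros D continuous_on_angular_smooth smooth_periodic_curvature_radius) auto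
  then have "closed (({0..2 * pi} \<times> {0..}) \<inter> \<kappa> -` {..0})"
    by (intro continuous_closed_preimage closed_Times) auto
  from closed_compact_projection[OF compact_Icc this]
  have "closed {t. \<exists>u. u \<in> {0..2 * pi} \<and> (u, t) \<in> ({0..2 * pi} \<times> {0..}) \<inter> \<kappa> -` {..0}}" .
  moreover have "nonconvex_times = {t. \<exists>u. u \<in> {0..2 * pi} \<and> (u, t) \<in> ({0..2 * pi} \<times> {0..}) \<inter> \<kappa> -` {..0}}"
  proof -
    have "(\<exists>u. mink_curvature h (\<Gamma> t) u \<le> 0) \<longleftrightarrow> (\<exists>u\<in>{0..2 * pi}. \<kappa> (u, t) \<le> 0)" if t: "t \<ge> 0" for t
    proof -
      interpret c: minkowski_curve h "\<Gamma> t" by (rule minkowski_curve_at[OF t])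
      have "\<forall>u. mink_curvature h (\<Gamma> t) (u + 2 * pi) = mink_curvature h (\<Gamma> t) u"
        using c.smooth_periodic_mink_curvature by (simp add: smooth_periodic_def)
      from periodic_representative[OF this] show ?thesis unfolding \<kappa>[OF t, symmetric] by metis
    qed
    then have "t \<in> nonconvex_times \<longleftrightarrow> (t \<ge> 0 \<and> (\<exists>u\<in>{0..2 * pi}. \<kappa> (u, t) \<le> 0))" for t
      unfolding nonconvex_times_def by blast
    then show ?thesis
      by (simp only: set_eq_iff mem_Collect_eq Int_iff mem_Times_iff vimage_eq fst_conv snd_conv
          atLeast_iff atMost_iff Bex_def) blast
  qed
  ultimately show ?thesis by simp
qed

text \<open>
  A curvature that is nonpositive at some point is positive at another one, since its integral is
  positive; in between it has a zero.
\<close>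

lemma energy_lower_bound:
  assumes bad: "t \<in> nonconvex_times" and "p \<ge> 1"
    and K: "mink_integral h (\<Gamma> t) (mink_curvature h (\<Gamma> t)) = K" "K > 0"
  shows "4 ^ (p - 1) * pi ^ (2 * p) * K\<^sup>2 \<le> (mink_length h (\<Gamma> t)) ^ (2 * p + 1) * energy t"
proof -
  have t: "t \<ge> 0" using bad by (simp add: nonconvex_times_def)
  interpret c: minkowski_curve h "\<Gamma> t" by (rule minkowski_curve_at[OF t])
  let ?\<kappa> = "mink_curvature h (\<Gamma> t)"
  obtain u where u: "?\<kappa> u \<le> 0" using bad by (auto simp: nonconvex_times_def)
  have "\<exists>v. ?\<kappa> v > 0"
  proof (rule ccontr)
    assume "\<nexists>v. ?\<kappa> v > 0"
    then have "K \<le> integral {0..2 * pi} (\<lambda>_. 0)"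
      unfolding K(1)[symmetric] c.mink_integral_eq
      by (intro integral_le integrable_continuous_interval smooth_periodic_continuous smooth_periodic_mult
          c.smooth_periodic_mink_curvature c.smooth_periodic_weight integrable_0)
        (auto simp: not_less mult_nonpos_nonneg c.weight_pos less_imp_le)
    then show False using K(2) by simp
  qed
  then obtain v where v: "?\<kappa> v > 0" by blast
  have "connected (range ?\<kappa>)"
    by (intro connected_continuous_image smooth_periodic_continuous c.smooth_periodic_mink_curvature) auto
  then have "0 \<in> range ?\<kappa>"
    using u v by (meson connected_iff_interval less_imp_le rangeI)
  then obtain u0 where "?\<kappa> u0 = 0" by force
  from c.curvature_energy_lower_bound[OF this assms(2)] show ?thesis
    by (simp add: K energy_def)
qed

end

text \<open>
  Integrating the rate \<open>g\<close> over \<open>[0, n]\<close> compares \<open>c\<close> times the measure of \<open>B \<inter> [0, n]\<close> with the decrease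
  of \<open>f\<close>. The Henstock-Kurzweil integral of \<open>g\<close> exists because \<open>- g\<close> is a derivative.
\<close>

lemma decay_time_bound:
  fixes f g :: "real \<Rightarrow> real"
  assumes d: "\<And>t. t \<ge> 0 \<Longrightarrow> (f has_vector_derivative - g t) (at t within {0..})"
    and g: "\<And>t. t \<ge> 0 \<Longrightarrow> g t \<ge> 0" "\<And>t. t \<in> B \<Longrightarrow> g t \<ge> c" and c: "c > 0"
    and B: "closed B" "B \<subseteq> {0..}"
    and lim: "(\<lambda>n. f (real n)) \<longlonglongrightarrow> m"
  shows "B \<in> lmeasurable" "c * measure lebesgue B \<le> f 0 - m"
proof -
  define C where "C n = B \<inter> {0..real n}" for n
  have C: "C n \<in> lmeasurable" for n
    unfolding C_def using B(1) by (intro lmeasurable_compact) (auto simp: closed_Int_compact)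
  have bound: "c * measure lebesgue (C n) \<le> f 0 - f (real n)" for n
  proof -
    have "((\<lambda>t. - g t) has_integral (f (real n) - f 0)) {0..real n}"
    proof (rule fundamental_theorem_of_calculus)
      show "(f has_vector_derivative - g t) (at t within {0..real n})" if "t \<in> {0..real n}" for t
        using that by (intro has_vector_derivative_within_subset[OF d]) auto
    qed simp
    from has_integral_neg[OF this] have G: "(g has_integral (f 0 - f (real n))) {0..real n}"
      by simp
    have "(indicator (C n) has_integral measure lebesgue (C n)) UNIV"
      using C[of n] lmeasurable_iff_indicator_has_integral by blast
    moreover have "indicator (C n) = (\<lambda>t. if t \<in> {0..real n} then indicator (C n) t else 0 :: real)"
      by (auto simp: C_def indicator_def)
    ultimately have "((\<lambda>t. if t \<in> {0..real n} then indicator (C n) t else 0) has_integral measure lebesgue (C n)) UNIV"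
      by (simp only:)
    then have "((\<lambda>t. c * indicator (C n) t) has_integral c * measure lebesgue (C n)) {0..real n}"
      unfolding has_integral_restrict_UNIV by (rule has_integral_mult_right)
    then show ?thesis
      using G by (rule has_integral_le) (use g in \<open>auto simp: C_def indicator_def\<close>)
  qed
  have mono: "measure lebesgue (C n) \<le> measure lebesgue (C k)" if "n \<le> k" for n k
    using that C by (intro measure_mono_fmeasurable) (auto simp: C_def fmeasurableD)
  have bound': "c * measure lebesgue (C n) \<le> f 0 - m" for n
  proof (rule LIMSEQ_le_const)
    show "(\<lambda>k. f 0 - f (real k)) \<longlonglongrightarrow> f 0 - m" by (intro tendsto_intros lim)
    show "\<exists>N. \<forall>k\<ge>N. c * measure lebesgue (C n) \<le> f 0 - f (real k)"
      using bound mono c by (meson mult_left_mono less_imp_le order_trans)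
  qed
  have Un: "B = (\<Union>n. C n)"
    using B(2) real_arch_simple by (fastforce simp: C_def)
  have "(\<Union>n. C n) \<in> lmeasurable \<and> measure lebesgue (\<Union>n. C n) \<le> (f 0 - m) / c"
  proof -
    have "measure lebesgue (\<Union>k\<le>n. C k) \<le> (f 0 - m) / c" for n
    proof -
      have "(\<Union>k\<le>n. C k) = C n" by (auto simp: C_def)
      then show ?thesis using bound'[of n] c by (simp add: field_simps)
    qed
    then show ?thesis
      using fmeasurable_countable_Union[of C lebesgue "(f 0 - m) / c"] measure_countable_Union_le[of C lebesgue "(f 0 - m) / c"] C by auto
  qed
  then show "B \<in> lmeasurable" "c * measure lebesgue B \<le> f 0 - m"
    using c by (simp_all add: Un[symmetric] field_simps)
qed

section \<open>Convexity of the indicatrix\<close>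

text \<open>
  In polar coordinates the curvature of the indicatrix has the sign of \<open>r\<^sup>2 + 2 r'\<^sup>2 - r r''\<close>, which
  equals \<open>r\<^sup>3 (h + h'')\<close> for \<open>h = 1 / r\<close>.
\<close>

lemma minkowski_plane_of_domain:
  assumes "minkowski_domain U r"
  shows "minkowski_plane (\<lambda>\<theta>. 1 / r \<theta>)"
proof
  have r: "smooth_fun r" and pos: "\<And>x. r x > 0" and per: "\<And>x. r (x + pi) = r x"
    and curv: "\<And>x. euclidean_curvature (\<lambda>\<theta>. r \<theta> *\<^sub>R cis \<theta>) x > 0"
    using assms by (auto simp: minkowski_domain_def)
  show "smooth_fun (\<lambda>\<theta>. 1 / r \<theta>)"
    using pos by (intro smooth_fun_divide smooth_fun_const r) (auto simp: less_imp_neq[symmetric])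
  show "1 / r (x + pi) = 1 / r x" for x by (simp add: per)
  show "1 / r x > 0" for x using pos by simp
  fix x
  define r1 where "r1 = vderiv r"
  define r2 where "r2 = vderiv r1"
  have r1: "smooth_fun r1" unfolding r1_def by (rule smooth_fun_SucD(2)[OF r])
  have dr: "(r has_real_derivative r1 x) (at x)" "(r1 has_real_derivative r2 x) (at x)" for x
    using smooth_fun_SucD(1)[OF r] smooth_fun_SucD(1)[OF r1]
    by (simp_all add: r1_def r2_def has_real_derivative_iff_has_vector_derivative)
  let ?c = "\<lambda>\<theta>. complex_of_real (r \<theta>) * cis \<theta>"
  have vel: "vderiv ?c = (\<lambda>\<theta>. (of_real (r1 \<theta>) + \<i> * of_real (r \<theta>)) * cis \<theta>)"
  proof (intro ext vderiv_eqI)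
    show "(?c has_vector_derivative (of_real (r1 \<theta>) + \<i> * of_real (r \<theta>)) * cis \<theta>) (at \<theta>)" for \<theta>
      using has_vector_derivative_mult[OF has_vector_derivative_of_real_vderiv[OF r] has_vector_derivative_cis]
      by (simp add: r1_def algebra_simps)
  qed
  have acc: "vderiv (vderiv ?c) \<theta> = (of_real (r2 \<theta> - r \<theta>) + \<i> * of_real (2 * r1 \<theta>)) * cis \<theta>" for \<theta>
  proof -
    have "(vderiv ?c has_vector_derivative (of_real (r1 \<theta>) + \<i> * of_real (r \<theta>)) * (\<i> * cis \<theta>)
        + (of_real (r2 \<theta>) + \<i> * of_real (r1 \<theta>)) * cis \<theta>) (at \<theta>)"
      unfolding vel r1_def r2_def
      by (intro has_vector_derivative_mult has_vector_derivative_add has_vector_derivative_mult_right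
          has_vector_derivative_of_real_vderiv has_vector_derivative_cis r r1[unfolded r1_def])
    from vderiv_eqI[OF this] show ?thesis by (simp add: algebra_simps)
  qed
  have nz: "vderiv ?c \<theta> \<noteq> 0" for \<theta>
  proof -
    have "of_real (r1 \<theta>) + \<i> * of_real (r \<theta>) \<noteq> (0::complex)"
      using pos[of \<theta>] by (auto simp: complex_eq_iff)
    then show ?thesis by (simp add: vel)
  qed
  have "smooth_fun ?c" by (intro smooth_fun_mult smooth_fun_linear[OF bounded_linear_of_real] r smooth_fun_cis)
  then have "0 < Im (vderiv (vderiv ?c) x / vderiv ?c x) / norm (vderiv ?c x)"
    using curv[of x] nz by (simp only: scaleR_conv_of_real euclidean_curvature_eq simp_thms)
  then have "0 < Im (vderiv (vderiv ?c) x / vderiv ?c x)"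
    by (simp add: zero_less_divide_iff)
  also have "vderiv (vderiv ?c) x / vderiv ?c x
      = (of_real (r2 x - r x) + \<i> * of_real (2 * r1 x)) / (of_real (r1 x) + \<i> * of_real (r x))"
    unfolding acc unfolding vel by simp
  also have "Im \<dots> = ((r x)\<^sup>2 + 2 * (r1 x)\<^sup>2 - r x * r2 x) / ((r1 x)\<^sup>2 + (r x)\<^sup>2)"
    by (simp add: Im_divide power2_eq_square algebra_simps)
  finally have num: "(r x)\<^sup>2 + 2 * (r1 x)\<^sup>2 - r x * r2 x > 0"
    by (smt (verit) divide_nonpos_nonneg zero_le_power2)
  have d1: "vderiv (\<lambda>\<theta>. 1 / r \<theta>) = (\<lambda>\<theta>. - r1 \<theta> / (r \<theta>)\<^sup>2)"
  proof (intro ext vderiv_eqI)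
    show "((\<lambda>\<theta>. 1 / r \<theta>) has_vector_derivative - r1 \<theta> / (r \<theta>)\<^sup>2) (at \<theta>)" for \<theta>
      unfolding has_real_derivative_iff_has_vector_derivative[symmetric]
      using pos[of \<theta>] by (auto intro!: derivative_eq_intros dr simp: power2_eq_square)
  qed
  have "vderiv (vderiv (\<lambda>\<theta>. 1 / r \<theta>)) x = (2 * (r1 x)\<^sup>2 - r x * r2 x) / (r x) ^ 3"
    unfolding d1
  proof (intro vderiv_eqI)
    show "((\<lambda>\<theta>. - r1 \<theta> / (r \<theta>)\<^sup>2) has_vector_derivative (2 * (r1 x)\<^sup>2 - r x * r2 x) / (r x) ^ 3) (at x)"
      unfolding has_real_derivative_iff_has_vector_derivative[symmetric]
      using pos[of x] by (auto intro!: derivative_eq_intros dr simp: field_simps power2_eq_square power3_eq_cube)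
  qed
  moreover have "1 / r x + (2 * (r1 x)\<^sup>2 - r x * r2 x) / (r x) ^ 3
      = ((r x)\<^sup>2 + 2 * (r1 x)\<^sup>2 - r x * r2 x) / (r x) ^ 3"
    using pos[of x] by (simp add: field_simps power2_eq_square power3_eq_cube)
  ultimately show "1 / r x + vderiv (vderiv (\<lambda>\<theta>. 1 / r \<theta>)) x > 0"
    using num pos[of x] by simp
qed

lemma polyharmonic_evolution_of_flow:
  assumes "minkowski_plane h" and flow: "polyharmonic_flow h p \<infinity> \<Gamma>"
  obtains D where "polyharmonic_evolution h p \<Gamma> D"
proof -
  have time: "time_interval \<infinity> = {0..}" by (auto simp: time_interval_def)
  have smooth: "smooth_family \<infinity> \<Gamma>" using flow by (simp add: polyharmonic_flow_def)
  then obtain D where D: "\<forall>t\<in>{0..}. \<forall>u. D 0 0 t u = \<Gamma> t u"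
    "\<forall>i j. continuous_on ({0..} \<times> UNIV) (\<lambda>(t, u). D i j t u) \<and>
           (\<forall>t\<in>{0..}. \<forall>u.
              ((\<lambda>v. D i j t v) has_vector_derivative D i (Suc j) t u) (at u) \<and>
              ((\<lambda>s. D i j s u) has_vector_derivative D (Suc i) j t u)
                (at t within {0..}))"
    unfolding smooth_family_def time by blast
  have "polyharmonic_evolution h p \<Gamma> D"
    using assms(1) D flow
    by (auto simp: polyharmonic_evolution_def polyharmonic_evolution_axioms_def polyharmonic_flow_def time)
  then show thesis by (rule that)
qed

section \<open>The bound on the time without convexity\<close>

theorem proposition1p2:
  fixes U :: "complex set" and r h :: "real \<Rightarrow> real" and p :: nat and \<epsilon>\<^sub>0 :: real
    and T :: ereal and \<Gamma> :: "real \<Rightarrow> real \<Rightarrow> complex"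
  assumes "minkowski_domain U r"
    and "h = (\<lambda>\<theta>. 1 / r \<theta>)"
    and "p \<ge> 1"
    and "\<epsilon>\<^sub>0 > 0"
    and "stability_property h p \<epsilon>\<^sub>0"
    and "maximal_polyharmonic_flow h p T \<Gamma>"
    and "regular_closed_curve (\<Gamma> 0)"
    and "enclosed_area (\<Gamma> 0) > 0"
    and "curvature_osc h (\<Gamma> 0) < \<epsilon>\<^sub>0"
    and "isoperimetric_ratio h (\<Gamma> 0) < exp (\<epsilon>\<^sub>0 / (8 * (enclosed_area (isoperimetrix h))\<^sup>2))"
  shows "T = \<infinity>
    \<and> {t. 0 \<le> t \<and> (\<exists>u. mink_curvature h (\<Gamma> t) u \<le> 0)} \<in> lmeasurable
    \<and> measure lebesgue {t. 0 \<le> t \<and> (\<exists>u. mink_curvature h (\<Gamma> t) u \<le> 0)}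
        \<le> 8 * enclosed_area (isoperimetrix h) ^ (p - 1) * enclosed_area (\<Gamma> 0) ^ (p + 1)
            / (real (p + 1) * pi ^ (2 * p))
          * (isoperimetric_ratio h (\<Gamma> 0) ^ (p + 1) - 1)"
proof -
  interpret minkowski_plane h
    unfolding assms(2) by (rule minkowski_plane_of_domain[OF assms(1)])
  define A where "A = enclosed_area (isoperimetrix h)"
  define A0 where "A0 = enclosed_area (\<Gamma> 0)"
  define I0 where "I0 = isoperimetric_ratio h (\<Gamma> 0)"
  have "almost_isoperimetric h \<epsilon>\<^sub>0 (\<Gamma> 0)"
    using assms by (simp add: almost_isoperimetric_def)
  then have "T = \<infinity> \<and> (\<exists>x\<^sub>0. \<exists>l>0.
      enclosed_area (\<lambda>\<theta>. x\<^sub>0 + l *\<^sub>R isoperimetrix h \<theta>) = enclosed_area (\<Gamma> 0) \<and>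
      converges_exponentially \<Gamma> (\<lambda>\<theta>. x\<^sub>0 + l *\<^sub>R isoperimetrix h \<theta>))"
    using assms(5,6) unfolding stability_property_def by blast
  then obtain x\<^sub>0 l where T: "T = \<infinity>" and l: "l > 0"
    and area: "enclosed_area (homothetic_isoperimetrix x\<^sub>0 l) = A0"
    and conv: "converges_exponentially \<Gamma> (homothetic_isoperimetrix x\<^sub>0 l)"
    unfolding homothetic_isoperimetrix_def[abs_def] A0_def by blast
  have "polyharmonic_flow h p \<infinity> \<Gamma>"
    using assms(6) T by (simp add: maximal_polyharmonic_flow_def)
  then obtain D where "polyharmonic_evolution h p \<Gamma> D"
    using polyharmonic_evolution_of_flow[OF minkowski_plane_axioms] by blast
  then interpret polyharmonic_evolution h p \<Gamma> D .
  have A0: "A0 = l\<^sup>2 * A" "A0 > 0"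
    using area_homothetic_isoperimetrix[of x\<^sub>0 l] area integral_density assms(8)
    by (simp_all add: A_def A0_def)
  then have A: "A > 0" using l by (simp add: zero_less_mult_iff)
  have "vderiv (homothetic_isoperimetrix x\<^sub>0 l) u \<noteq> 0" for u
    using l convex[of u] by (simp add: homothetic_isoperimetrix_velocity flip: of_real_add)
  note limit = regular conv smooth_fun_homothetic_isoperimetrix this
  let ?L = "\<lambda>t. mink_length h (\<Gamma> t)"
  let ?K = "\<lambda>t. mink_integral h (\<Gamma> t) (mink_curvature h (\<Gamma> t))"
  have L_lim: "(\<lambda>n. ?L (real n)) \<longlonglongrightarrow> 2 * l * A"
    using mink_length_limit[OF limit] homothetic_isoperimetrix_limits(1)[OF l] by (simp add: A_def)
  have "(\<lambda>n. ?K (real n)) \<longlonglongrightarrow> 2 * A"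
    using total_curvature_limit[OF limit] homothetic_isoperimetrix_limits(2)[OF l] by (simp add: A_def)
  moreover have "?K (real n) = ?K 0" for n by (rule total_curvature_constant) simp
  ultimately have "?K 0 = 2 * A" by (simp add: LIMSEQ_const_iff)
  then have K: "?K t = 2 * A" if "t \<ge> 0" for t using total_curvature_constant[OF that] by simp
  have Lpos: "?L t > 0" if "t \<ge> 0" for t
    by (rule minkowski_curve.mink_length_pos[OF minkowski_curve_at[OF that]])
  \<comment> \<open>The rate at which \<open>L\<^sup>2\<^sup>p\<^sup>+\<^sup>2\<close> decreases, at least, while the curve is not convex.\<close>
  define c where "c = real (2 * p + 2) * (4 ^ (p - 1) * pi ^ (2 * p) * (2 * A)\<^sup>2)"
  have c: "c > 0" using A by (simp add: c_def)
  have nonneg: "real (2 * p + 2) * (?L t ^ (2 * p + 1) * energy t) \<ge> 0" if "t \<ge> 0" for t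
    using Lpos[OF that] energy_nonneg[OF that] by simp
  have decay: "((\<lambda>t. ?L t ^ (2 * p + 2)) has_vector_derivative
      - (real (2 * p + 2) * (?L t ^ (2 * p + 1) * energy t))) (at t within {0..})" if "t \<ge> 0" for t
  proof -
    have "((\<lambda>t. ?L t ^ (2 * p + 2)) has_real_derivative
        real (2 * p + 2) * (- energy t * ?L t ^ (2 * p + 2 - Suc 0))) (at t within {0..})"
      using length_decay[OF that]
      by (intro DERIV_power) (simp add: has_real_derivative_iff_has_vector_derivative)
    then show ?thesis by (simp add: has_real_derivative_iff_has_vector_derivative algebra_simps)
  qed
  have strong: "real (2 * p + 2) * (?L t ^ (2 * p + 1) * energy t) \<ge> c" if "t \<in> nonconvex_times" for t
    unfolding c_def using energy_lower_bound[OF that assms(3) K] that A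
    by (intro mult_left_mono) (auto simp: nonconvex_times_def)
  have "nonconvex_times \<subseteq> {0..}" by (auto simp: nonconvex_times_def)
  note bound = decay_time_bound[OF decay nonneg strong c closed_nonconvex_times this tendsto_power[OF L_lim]]
  have "0 \<le> c * measure lebesgue nonconvex_times" using c by simp
  have sq: "x ^ (2 * p + 2) = (x\<^sup>2) ^ (p + 1)" for x :: real
  proof -
    have "2 * p + 2 = 2 * (p + 1)" by simp
    then show ?thesis by (simp only: power_mult)
  qed
  have L0: "?L 0 ^ (2 * p + 2) = (4 * A0 * A) ^ (p + 1) * I0 ^ (p + 1)"
  proof -
    have "(?L 0)\<^sup>2 = (4 * A0 * A) * I0"
      using A A0(2) by (simp add: I0_def isoperimetric_ratio_def A_def A0_def)
    then show ?thesis by (simp only: sq power_mult_distrib)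
  qed
  have Linf: "(2 * l * A) ^ (2 * p + 2) = (4 * A0 * A) ^ (p + 1)"
  proof -
    have "(2 * l * A)\<^sup>2 = 4 * A0 * A" by (simp add: A0 power2_eq_square)
    then show ?thesis by (simp only: sq)
  qed
  have main: "c * measure lebesgue nonconvex_times \<le> (4 * A0 * A) ^ (p + 1) * (I0 ^ (p + 1) - 1)"
    using bound(2) by (simp only: L0 Linf) (simp add: algebra_simps)
  have pos: "I0 ^ (p + 1) - 1 \<ge> 0"
  proof -
    have "0 \<le> (4 * A0 * A) ^ (p + 1) * (I0 ^ (p + 1) - 1)"
      using main \<open>0 \<le> c * measure lebesgue nonconvex_times\<close> by linarith
    moreover have "(4 * A0 * A) ^ (p + 1) > 0" using A A0(2) by simp
    ultimately show ?thesis by (simp only: zero_le_mult_iff) linarith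
  qed
  define M where "M = A ^ (p - 1) * A0 ^ (p + 1) / (real (p + 1) * pi ^ (2 * p))"
  have M: "M \<ge> 0" using A A0(2) by (simp add: M_def)
  have cM: "(4 * A0 * A) ^ (p + 1) = c * (2 * M)"
  proof -
    obtain q where q: "p = Suc q" using assms(3) by (cases p) auto
    define k where "k = real (p + 1)"
    define P where "P = pi ^ (2 * p)"
    have "k > 0" "P > 0" "real (2 * p + 2) = 2 * k" by (simp_all add: k_def P_def)
    then have "c * (2 * M) = 16 * 4 ^ (p - 1) * A\<^sup>2 * A ^ (p - 1) * A0 ^ (p + 1)"
      unfolding M_def c_def k_def[symmetric] P_def[symmetric] by (simp add: field_simps power2_eq_square)
    then show ?thesis by (simp add: q power_mult_distrib power2_eq_square)
  qed
  have "c * measure lebesgue nonconvex_times \<le> c * (2 * M * (I0 ^ (p + 1) - 1))"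
    using main unfolding cM by (simp add: mult.assoc)
  then have "measure lebesgue nonconvex_times \<le> 2 * M * (I0 ^ (p + 1) - 1)"
    using c by simp
  \<comment> \<open>With the sharp constants in the Wirtinger inequalities, the factor is 2 instead of 8.\<close>
  also have "\<dots> \<le> 8 * M * (I0 ^ (p + 1) - 1)"
    using pos M by (intro mult_right_mono) auto
  finally have "measure lebesgue nonconvex_times \<le> 8 * M * (I0 ^ (p + 1) - 1)" .
  then show ?thesis
    using T bound(1) unfolding M_def A_def A0_def I0_def nonconvex_times_def by simp
qed

end
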